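(* Let $Q=[0,1]^d$, let $X=\mathcal{W}^L(Q)$ be the tree-like function space for fully connected ReLU networks with $L$ hidden layers, let $Y=C^{0,1}(Q)$ be the space of Lipschitz-continuous functions on $Q$ (with respect to the $\ell^\infty$-norm on $\mathbb{R}^d$), and let $Z=L^2(Q)$. Let \[ \rho(t) = \sup_{\|\phi\|_Y\leq 1}\ \inf_{\|f\|_X\leq t}\|\phi-f\|_{L^2(Q)} . \] Then \[ \rho(t) \geq 2^{-\frac1d}\, \frac{\big(c_d/2\big)^{\frac{d}{d-2}}}{C_d\,\left(3\cdot 2^{L+2}\sqrt{2\,\log(2d+2)}\right)^{\frac{2}{d-2}}}\,t^{-\frac{2}{d-2}} = \bar c_d\,2^{-\frac{L}{d-2}}\,t^{-\frac{2}{d-2}} \] for a dimension-dependent constant $\bar c_d>0$. Here $c_d,C_d>0$ are the dimension-dependent constants described in the context.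
   Context: The norm on $Y$ is $\|\phi\|_Y=\sup_{x\in Q}|\phi(x)|+\sup_{x\ne y}\frac{|\phi(x)-\phi(y)|}{|x-y|_{\ell^\infty}}$, and $L^2(Q)$ is taken with respect to Lebesgue measure. The constants $c_d,C_d>0$ depend only on $d$ and are such that, with $\varepsilon_n=\gamma_d n^{-1/d}$ for a suitable dimension-dependent $\gamma_d>0$, for every $n\in\mathbb{N}$ there are points $x_1,\dots,x_n\in Q$ for which the functional $\phi\mapsto \frac1n\sum_{i=1}^n \frac{1}{|B_{\varepsilon_n}(x_i)|}\int_{B_{\varepsilon_n}(x_i)}\phi\,\mathrm{d}x-\int_Q\phi\,\mathrm{d}x$ has supremum at least $c_d n^{-1/d}$ over the unit ball of $Y$, at most $C_d$ over the unit ball of $Z$, and at most $3C_X n^{-1/2}$ over the unit ball of $X$, where $C_X$ is the constant in the Monte-Carlo estimate $\mathbb{E}\sup_{\|\phi\|_X\le1}\big[\frac1n\sum_i\phi(X_i)-\int_Q\phi\,\mathrm{d}x\big]\le C_X n^{-1/2}$ for $X_i$ independent and uniform on $Q$ (balls are understood periodically, on the flat torus $\mathbb{R}^d/\mathbb{Z}^d$). Tree-like function spaces on $Q$ are defined inductively; let $\sigma(z)=\max\{z,0\}$. $\mathcal{W}^0(Q)$ is the space of affine functions $x\mapsto w^Tx+b$ ($w\in\mathbb{R}^d$, $b\in\mathbb{R}$) restricted to $Q$, with norm $|w|_{\ell^1}+|b|$. For $L\ge 1$, let $B^{L-1}$ be the closed unit ball of $\mathcal{W}^{L-1}(Q)$,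 considered as a subset of $C(Q)$ with the supremum norm. Then $\mathcal{W}^L(Q)$ consists of all functions $f_\mu(x)=\int_{B^{L-1}}\sigma(g(x))\,\mu(\mathrm{d}g)$, where $\mu$ is a finite signed Radon measure on $B^{L-1}$, with norm $\|f\|_{\mathcal{W}^L}=\inf\{\|\mu\|_{TV}: f=f_\mu\text{ on }Q\}$, where $\|\cdot\|_{TV}$ is the total variation norm.
   Formalization: Needs d≥3; the explicit bound is for c_d/2 ≤ 3·2^{L+2}√(2log(2d+2))·t (it fails as t→0, since ρ≤1); the equality has 2^{-2L/(d-2)} (the printed exponent is wrong for a c̄_d free of L), and the printed outer bound with 2^{-L/(d-2)} is stated for t≥1. *)

theory Defs
  imports "HOL-Probability.Probability"
begin

text \<open>
  A function on the cube is represented by a total function of which only the values on the cube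
  matter; where functions are themselves points of a space (the tree-like spaces and \<open>C(Q)\<close>)
  they are taken in \<open>extensional\<close> form, so that equality means equality on the cube.
\<close>

abbreviation unit_cube :: "(real ^ 'd) set" where
  "unit_cube \<equiv> cbox 0 1"

definition relu :: "real \<Rightarrow> real" where
  "relu z = max z 0"


section \<open>Finite signed Radon measures on subsets of \<open>C(Q)\<close>\<close>

definition cube_topology :: "((real ^ 'd) \<Rightarrow> real) set \<Rightarrow> ((real ^ 'd) \<Rightarrow> real) topology" where
  "cube_topology B =
     subtopology (mtopology_of (cfunspace (top_of_set unit_cube) euclidean_metric)) B"

definition cube_borel :: "((real ^ 'd) \<Rightarrow> real) set \<Rightarrow> ((real ^ 'd) \<Rightarrow> real) measure" where
  "cube_borel B = sigma (topspace (cube_topology B)) {U. openin (cube_topology B) U}"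

definition finite_radon ::
  "((real ^ 'd) \<Rightarrow> real) set \<Rightarrow> ((real ^ 'd) \<Rightarrow> real) measure \<Rightarrow> bool" where
  "finite_radon B M \<longleftrightarrow>
     sets M = sets (cube_borel B) \<and> finite_measure M \<and>
     (\<forall>A\<in>sets M. emeasure M A = (SUP K\<in>{K. K \<subseteq> A \<and> compactin (cube_topology B) K}. emeasure M K))"

text \<open>
  A finite signed measure is given by its Jordan decomposition: a pair of mutually singular finite
  measures \<open>P\<close>, \<open>N\<close> stands for \<open>P - N\<close>. By the Hahn--Jordan theorem this is a bijection between
  such pairs and finite signed measures, integration against the signed measure is the difference
  of the two integrals, and the total variation norm is the sum of the two total masses.
\<close>

definition signed_radon ::
  "((real ^ 'd) \<Rightarrow> real) set \<Rightarrow> ((real ^ 'd) \<Rightarrow> real) measure \<Rightarrow> ((real ^ 'd) \<Rightarrow> real) measure \<Rightarrow> bool"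
  where
  "signed_radon B P N \<longleftrightarrow>
     finite_radon B P \<and> finite_radon B N \<and>
     (\<exists>S\<in>sets P. emeasure P (space P - S) = 0 \<and> emeasure N S = 0)"

definition tv_norm :: "'a measure \<Rightarrow> 'a measure \<Rightarrow> ennreal" where
  "tv_norm P N = emeasure P (space P) + emeasure N (space N)"

definition relu_superposition ::
  "((real ^ 'd) \<Rightarrow> real) measure \<Rightarrow> ((real ^ 'd) \<Rightarrow> real) measure \<Rightarrow> (real ^ 'd) \<Rightarrow> real" where
  "relu_superposition P N = (\<lambda>x\<in>unit_cube. (LINT g|P. relu (g x)) - (LINT g|N. relu (g x)))"


section \<open>Function spaces\<close>

text \<open>
  The infimum over the empty set is \<open>\<infinity>\<close>, so \<open>f\<close> belongs to the space of depth \<open>L\<close> iff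
  \<open>tree_norm L f < \<infinity>\<close>. For \<open>L = 0\<close> the infimum is over the unique pair representing the affine
  function \<open>f\<close>.
\<close>

primrec tree_norm :: "nat \<Rightarrow> ((real ^ 'd) \<Rightarrow> real) \<Rightarrow> ennreal" where
  "tree_norm 0 f =
     (INF (w, b)\<in>{(w, b). f = (\<lambda>x\<in>unit_cube. w \<bullet> x + b)}. ennreal ((\<Sum>i\<in>UNIV. \<bar>w $ i\<bar>) + \<bar>b\<bar>))"
| "tree_norm (Suc L) f =
     (INF (P, N)\<in>{(P, N). signed_radon {g. tree_norm L g \<le> 1} P N \<and> f = relu_superposition P N}.
        tv_norm P N)"

definition tree_ball :: "nat \<Rightarrow> real \<Rightarrow> ((real ^ 'd) \<Rightarrow> real) set" where
  "tree_ball L r = {f. tree_norm L f \<le> ennreal r}"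

definition lipschitz_norm :: "((real ^ 'd) \<Rightarrow> real) \<Rightarrow> ennreal" where
  "lipschitz_norm \<phi> =
     (SUP x\<in>unit_cube. ennreal \<bar>\<phi> x\<bar>) +
     (SUP (x, y)\<in>{(x, y). x \<in> unit_cube \<and> y \<in> unit_cube \<and> x \<noteq> y}.
        ennreal (\<bar>\<phi> x - \<phi> y\<bar> / infnorm (x - y)))"

definition lipschitz_ball :: "((real ^ 'd) \<Rightarrow> real) set" where
  "lipschitz_ball = {\<phi>. lipschitz_norm \<phi> \<le> 1}"

definition L2_norm :: "((real ^ 'd) \<Rightarrow> real) \<Rightarrow> real" where
  "L2_norm \<phi> = sqrt (LINT x:unit_cube|lebesgue. (\<phi> x)\<^sup>2)"

definition L2_ball :: "((real ^ 'd) \<Rightarrow> real) set" where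
  "L2_ball = {\<phi>. \<phi> \<in> borel_measurable (lebesgue_on unit_cube) \<and>
                 integrable (lebesgue_on unit_cube) (\<lambda>x. (\<phi> x)\<^sup>2) \<and> L2_norm \<phi> \<le> 1}"

definition rho :: "'d::finite itself \<Rightarrow> nat \<Rightarrow> real \<Rightarrow> ereal" where
  "rho TYPE('d) L t =
     (SUP \<phi>\<in>(lipschitz_ball :: ((real ^ 'd) \<Rightarrow> real) set).
        INF f\<in>tree_ball L t. ereal (L2_norm (\<lambda>x. \<phi> x - f x)))"


section \<open>The dimension-dependent constants\<close>

text \<open>
  \<open>C\<close> is a constant in the Monte-Carlo estimate for the unit ball of the space of depth \<open>L\<close>.
  That ball contains the zero function, so the truncation at 0 inside \<open>ennreal\<close> does not change
  the supremum.
\<close>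

definition monte_carlo :: "'d::finite itself \<Rightarrow> nat \<Rightarrow> real \<Rightarrow> bool" where
  "monte_carlo TYPE('d) L C \<longleftrightarrow>
     (\<forall>n::nat. n \<ge> 1 \<longrightarrow>
        (\<integral>\<^sup>+ x. (SUP f\<in>(tree_ball L 1 :: ((real ^ 'd) \<Rightarrow> real) set).
                  ennreal ((\<Sum>i<n. f (x i)) / real n - (LINT y:unit_cube|lebesgue. f y)))
           \<partial>(\<Pi>\<^sub>M i\<in>{..<n}. uniform_measure lborel unit_cube))
        \<le> ennreal (C * real n powr (- (1 / 2))))"

text \<open>The ball of the flat torus, with the cube as (almost everywhere unique) set of representatives.\<close>

definition periodic_ball :: "real ^ 'd \<Rightarrow> real \<Rightarrow> (real ^ 'd) set" where
  "periodic_ball x r = {y \<in> unit_cube. \<exists>k. (\<forall>i. k $ i \<in> \<int>) \<and> dist (x + k) y < r}"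

definition ball_discrepancy ::
  "real \<Rightarrow> nat \<Rightarrow> (nat \<Rightarrow> real ^ 'd) \<Rightarrow> ((real ^ 'd) \<Rightarrow> real) \<Rightarrow> real" where
  "ball_discrepancy r n x \<phi> =
     (\<Sum>i<n. (LINT y:periodic_ball (x i) r|lebesgue. \<phi> y) / measure lebesgue (periodic_ball (x i) r))
       / real n
     - (LINT y:unit_cube|lebesgue. \<phi> y)"

text \<open>
  The constants do not depend on the depth \<open>L\<close>, on the number \<open>n\<close> of points or on the Monte-Carlo
  constant \<open>CX\<close>; the points may.
\<close>

definition discrepancy_constants :: "'d::finite itself \<Rightarrow> real \<Rightarrow> real \<Rightarrow> bool" where
  "discrepancy_constants TYPE('d) c C \<longleftrightarrow>
     c > 0 \<and> C > 0 \<and>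
     (\<exists>\<gamma>>0. \<forall>L CX. monte_carlo TYPE('d) L CX \<longrightarrow>
        (\<forall>n::nat. n \<ge> 1 \<longrightarrow>
           (\<exists>x :: nat \<Rightarrow> real ^ 'd.
              let A = ball_discrepancy (\<gamma> * real n powr (- (1 / real CARD('d)))) n x in
              (\<forall>i<n. x i \<in> unit_cube) \<and>
              (SUP \<phi>\<in>lipschitz_ball. ereal (A \<phi>)) \<ge> ereal (c * real n powr (- (1 / real CARD('d)))) \<and>
              (SUP \<phi>\<in>L2_ball. ereal (A \<phi>)) \<le> ereal C \<and>
              (SUP f\<in>tree_ball L 1. ereal (A f)) \<le> ereal (3 * CX * real n powr (- (1 / 2))))))"

end

theory Submission
  imports Defs
begin

text \<open>
  If the discrepancy functional \<open>A\<close> of \<open>n\<close> points is at least \<open>c * n powr (-1/d)\<close> at \<open>\<phi>\<close>, then splitting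
  \<open>A \<phi> = A (\<phi> - f) + A f\<close> for \<open>f\<close> of norm at most \<open>t\<close> gives
  \<open>c * n powr (-1/d) \<le> C * L2_norm (\<phi> - f) + K * t * n powr (-1/2)\<close>, and one optimises over \<open>n\<close>.

  It remains to bound the Monte-Carlo constant of the tree-like spaces, and through it \<open>K\<close>. The contraction
  principle for the averages over signs loses a factor 2 per layer, which is too much for the
  dependence \<open>2 powr (- L / (d - 2))\<close> on the depth with the same constant. Following Golowich, Rakhlin and
  Shamir, contraction is applied to the moment generating function instead: the factor \<open>2 ^ L\<close> then
  appears inside a logarithm, the Monte-Carlo constant grows only like \<open>sqrt L\<close>, and a growth of
  \<open>2 powr (L / 2)\<close> suffices.
\<close>

section \<open>Rademacher sums\<close>

text \<open>The constant \<open>K = 3 * 2 ^ (L + 2) * sqrt (2 * ln (2 * d + 2))\<close> enters with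
  exponent \<open>2 / (d - 2)\<close> and so contributes
  \<open>2 powr (- (2 * L / (d - 2)))\<close>. The decay \<open>2 powr (- (L / (d - 2)))\<close>
  therefore asks for a Monte-Carlo constant of order at most \<open>2 powr (L / 2)\<close>. A better
  one can be used with the same \<open>c\<close> and \<open>C\<close> because
  \<open>discrepancy_constants\<close> fixes these before \<open>L\<close> and \<open>CX\<close>.

  Under the exponential each operation of a layer is harmless: the supremum over signed measures
  reduces to single neurons up to sign, the sign costs a factor 2 outside the exponential, and
  contraction removes \<open>relu\<close> without loss. In the symmetrisation the obstacle is
  measurability: the supremum runs over an uncountable ball and is replaced by one over a countable,
  pointwise sequentially dense subset.\<close>

definition rademacher :: "'i set \<Rightarrow> 'i \<Rightarrow> real" where
  "rademacher E i = (if i \<in> E then 1 else -1)"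

text \<open>A sign vector on \<open>A\<close> is encoded by the set \<open>E\<close> of its positive
  coordinates, so averages over signs are finite sums over \<open>Pow A\<close>. Splitting off the
  sign of \<open>k\<close> drives the inductions on \<open>A\<close>.\<close>

lemma sum_Pow_insert:
  fixes F :: "'i set \<Rightarrow> 'a::comm_monoid_add"
  assumes "finite A" "k \<notin> A"
  shows "(\<Sum>E\<in>Pow (insert k A). F E) = (\<Sum>E\<in>Pow A. F (insert k E) + F E)"
proof -
  have "inj_on (insert k) (Pow A)"
    using assms(2) by (intro inj_onI) auto
  moreover have "Pow A \<inter> insert k ` Pow A = {}"
    using assms(2) by auto
  ultimately show ?thesis
    using assms(1) unfolding Pow_insert
    by (subst sum.union_disjoint) (auto simp: sum.reindex sum.distrib add.commute)
qed

lemma sum_rademacher_insert: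
  assumes "finite A" "k \<notin> A" "E \<subseteq> A"
  shows "(\<Sum>i\<in>insert k A. rademacher (insert k E) i * z i) = z k + (\<Sum>i\<in>A. rademacher E i * z i)"
    and "(\<Sum>i\<in>insert k A. rademacher E i * z i) = - z k + (\<Sum>i\<in>A. rademacher E i * z i)"
proof -
  have "(\<Sum>i\<in>A. rademacher (insert k E) i * z i) = (\<Sum>i\<in>A. rademacher E i * z i)"
    using assms by (intro sum.cong) (auto simp: rademacher_def)
  then show "(\<Sum>i\<in>insert k A. rademacher (insert k E) i * z i) = z k + (\<Sum>i\<in>A. rademacher E i * z i)"
    using assms by (simp add: rademacher_def)
  show "(\<Sum>i\<in>insert k A. rademacher E i * z i) = - z k + (\<Sum>i\<in>A. rademacher E i * z i)"
    using assms by (auto simp: rademacher_def)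
qed

lemma cosh_le_exp_square: "exp x + exp (- x) \<le> 2 * exp (x\<^sup>2 / 2)" for x :: real
proof -
  have *: "exp y + exp (- y) \<le> 2 * exp (y\<^sup>2 / 2)" if "y \<ge> 0" for y :: real
  proof -
    \<comment> \<open>Hoeffding's lemma for a fair coin on an interval of length
      \<open>2 * y\<close>. It needs a nonnegative length; evenness covers negative
      arguments.\<close>
    have "- (2 * y) * (1/2) + ln (1 + 1/2 * (exp (2 * y) - 1)) \<le> (2 * y)\<^sup>2 / 8"
      using that by (intro Hoeffdings_lemma_aux) auto
    then have "ln ((1 + exp (2 * y)) / 2) \<le> y + y\<^sup>2 / 2"
      by (simp add: field_simps power2_eq_square)
    then have "(1 + exp (2 * y)) / 2 \<le> exp (y + y\<^sup>2 / 2)"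
      by (subst ln_ge_iff [symmetric, where y = "y + y\<^sup>2 / 2"] exp_le_cancel_iff [symmetric])
         (metis add_pos_pos divide_pos_pos exp_gt_zero exp_le_cancel_iff exp_ln zero_less_numeral zero_less_one)
    then have "(1 + exp (2 * y)) * exp (- y) \<le> 2 * exp (y + y\<^sup>2 / 2) * exp (- y)"
      by (intro mult_right_mono) auto
    then show ?thesis
      by (simp add: distrib_right mult_exp_exp mult.assoc)
  qed
  show ?thesis
    using *[of "x"] *[of "- x"] by (cases "x \<ge> 0") auto
qed

text \<open>Independence of the signs: the sum factorises into the numbers
  \<open>exp (z i) + exp (- z i)\<close>, each of which is sub-Gaussian.\<close>

lemma rademacher_mgf:
  fixes z :: "'i \<Rightarrow> real"
  assumes "finite A"
  shows "(\<Sum>E\<in>Pow A. exp (\<Sum>i\<in>A. rademacher E i * z i)) \<le> 2 ^ card A * exp ((\<Sum>i\<in>A. (z i)\<^sup>2) / 2)"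
  using assms
proof (induction A)
  case (insert k A)
  let ?S = "\<Sum>E\<in>Pow A. exp (\<Sum>i\<in>A. rademacher E i * z i)"
  have "(\<Sum>E\<in>Pow (insert k A). exp (\<Sum>i\<in>insert k A. rademacher E i * z i)) =
      (\<Sum>E\<in>Pow A. (exp (z k) + exp (- z k)) * exp (\<Sum>i\<in>A. rademacher E i * z i))"
  proof (subst sum_Pow_insert[OF insert.hyps], rule sum.cong[OF refl], goal_cases)
    case (1 E)
    then show ?case
      using sum_rademacher_insert[OF insert.hyps, of E] by (simp only: Pow_iff exp_add distrib_right)
  qed
  also have "\<dots> = (exp (z k) + exp (- z k)) * ?S"
    by (simp add: sum_distrib_left)
  also have "\<dots> \<le> (2 * exp ((z k)\<^sup>2 / 2)) * (2 ^ card A * exp ((\<Sum>i\<in>A. (z i)\<^sup>2) / 2))"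
    using insert.IH cosh_le_exp_square[of "z k"] by (intro mult_mono) (auto intro!: sum_nonneg)
  also have "\<dots> = 2 ^ card (insert k A) * exp ((\<Sum>i\<in>insert k A. (z i)\<^sup>2) / 2)"
    using insert.hyps by (simp add: add_divide_distrib exp_add)
  finally show ?case .
qed auto

text \<open>Reduces a sum of two suprema to pairs \<open>s\<close>, \<open>t\<close> chosen
  independently, so that contraction may exchange their roles.\<close>

lemma SUP_ennreal_add_le:
  fixes f h :: "'g \<Rightarrow> ennreal"
  assumes "\<And>s t. s \<in> G \<Longrightarrow> t \<in> G \<Longrightarrow> f s + h t \<le> R"
  shows "(SUP s\<in>G. f s) + (SUP t\<in>G. h t) \<le> R"
proof (cases "G = {}")
  case False
  have "f s + (SUP t\<in>G. h t) \<le> R" if "s \<in> G" for s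
    using False that by (subst ennreal_SUP_add_right) (auto intro!: SUP_least assms)
  then show ?thesis
    using False by (subst ennreal_SUP_add_left [symmetric]) (auto intro!: SUP_least)
qed (simp add: bot_ennreal)

text \<open>The one-coordinate case of the contraction principle. If both \<open>v s\<close> and \<open>v t\<close> are negative it
  rests on the convexity of \<open>exp\<close>, in all other cases the left-hand terms are bounded one by one.\<close>

lemma relu_contraction_pair:
  fixes u v :: "'g \<Rightarrow> real"
  shows "(SUP g\<in>G. ennreal (exp (u g + relu (v g)))) + (SUP g\<in>G. ennreal (exp (u g - relu (v g))))
       \<le> (SUP g\<in>G. ennreal (exp (u g + v g))) + (SUP g\<in>G. ennreal (exp (u g - v g)))"
    (is "_ \<le> ?P + ?N")
proof (rule SUP_ennreal_add_le)
  fix s t assume st: "s \<in> G" "t \<in> G"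
  have P: "ennreal (exp (u g + v g)) \<le> ?P" and N: "ennreal (exp (u g - v g)) \<le> ?N" if "g \<in> G" for g
    using that by (auto intro: SUP_upper)
  show "ennreal (exp (u s + relu (v s))) + ennreal (exp (u t - relu (v t))) \<le> ?P + ?N"
  proof (cases "v s \<ge> 0")
    case True
    have "ennreal (exp (u s + relu (v s))) \<le> ?P"
      using P[OF st(1)] True by (simp add: relu_def)
    moreover have "ennreal (exp (u t - relu (v t))) \<le> ennreal (exp (u t - v t))"
      by (intro ennreal_leI) (simp add: relu_def)
    ultimately show ?thesis
      using N[OF st(2)] by (meson add_mono order_trans)
  next
    case vs: False
    show ?thesis
    proof (cases "v t \<ge> 0")
      case True
      \<comment> \<open>Here \<open>v s < 0 \<le> v t\<close>, and the two points change roles: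
        \<open>s\<close> is charged to \<open>?N\<close> and \<open>t\<close> to
        \<open>?P\<close>.\<close>
      have "ennreal (exp (u s + relu (v s))) \<le> ennreal (exp (u s - v s))"
        using vs by (intro ennreal_leI) (simp add: relu_def)
      moreover have "ennreal (exp (u t - relu (v t))) \<le> ennreal (exp (u t + v t))"
        using True by (intro ennreal_leI) (simp add: relu_def)
      ultimately show ?thesis
        using N[OF st(1)] P[OF st(2)] by (subst add.commute) (meson add_mono order_trans)
    next
      case vt: False
      have *: "2 * ennreal (exp (u g)) \<le> ?P + ?N" if "g \<in> G" for g
      proof -
        have "2 * 1 \<le> exp (v g) + exp (- v g)"
          using cosh_real_ge_1[of "v g"] by (simp add: cosh_field_def)
        then have "2 * exp (u g) \<le> exp (u g) * (exp (v g) + exp (- v g))"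
          by (metis exp_ge_zero mult.commute mult.right_neutral mult_left_mono)
        then have "2 * exp (u g) \<le> exp (u g + v g) + exp (u g - v g)"
          by (simp add: exp_add exp_diff exp_minus field_simps)
        then have "ennreal (2 * exp (u g)) \<le> ennreal (exp (u g + v g) + exp (u g - v g))"
          by (rule ennreal_leI)
        also have "\<dots> \<le> ?P + ?N"
          using P[OF that] N[OF that] by (simp add: add_mono)
        finally show ?thesis
          by (simp add: ennreal_mult)
      qed
      have "2 * (ennreal (exp (u s)) + ennreal (exp (u t))) \<le> 2 * (?P + ?N)"
        using add_mono[OF *[OF st(1)] *[OF st(2)]] by (simp only: mult_2 ac_simps)
      then have "ennreal (exp (u s)) + ennreal (exp (u t)) \<le> ?P + ?N"
        by (subst (asm) ennreal_mult_le_mult_iff) auto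
      then show ?thesis
        using vs vt by (simp add: relu_def)
    qed
  qed
qed

text \<open>The offset \<open>u\<close> is arbitrary so that it can absorb coordinates. The pair
  lemma treats coordinate \<open>k\<close> with the other \<open>relu\<close> terms as offset;
  afterwards \<open>v g k\<close> itself, with either sign, joins the offset in the induction
  hypothesis.\<close>

lemma relu_contraction:
  fixes u :: "'g \<Rightarrow> real" and v :: "'g \<Rightarrow> 'i \<Rightarrow> real"
  assumes "finite A"
  shows "(\<Sum>E\<in>Pow A. SUP g\<in>G. ennreal (exp (u g + (\<Sum>i\<in>A. rademacher E i * relu (v g i)))))
       \<le> (\<Sum>E\<in>Pow A. SUP g\<in>G. ennreal (exp (u g + (\<Sum>i\<in>A. rademacher E i * v g i))))"
  using assms
proof (induction A arbitrary: u)
  case (insert k A)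
  have split: "(\<Sum>E\<in>Pow (insert k A). SUP g\<in>G. ennreal (exp (u g + (\<Sum>i\<in>insert k A. rademacher E i * w g i)))) =
      (\<Sum>E\<in>Pow A. (SUP g\<in>G. ennreal (exp (u g + w g k + (\<Sum>i\<in>A. rademacher E i * w g i)))) +
                  (SUP g\<in>G. ennreal (exp (u g - w g k + (\<Sum>i\<in>A. rademacher E i * w g i)))))" for w
  proof (subst sum_Pow_insert[OF insert.hyps], rule sum.cong[OF refl], goal_cases)
    case (1 E)
    have "u g + (w g k + s) = u g + w g k + s" "u g + (- w g k + s) = u g - w g k + s" for g s
      by auto
    then show ?case
      using sum_rademacher_insert[OF insert.hyps, of E] 1 by (simp only: Pow_iff)
  qed
  have "(\<Sum>E\<in>Pow (insert k A). SUP g\<in>G. ennreal (exp (u g + (\<Sum>i\<in>insert k A. rademacher E i * relu (v g i)))))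
      \<le> (\<Sum>E\<in>Pow A. (SUP g\<in>G. ennreal (exp (u g + v g k + (\<Sum>i\<in>A. rademacher E i * relu (v g i))))) +
                  (SUP g\<in>G. ennreal (exp (u g - v g k + (\<Sum>i\<in>A. rademacher E i * relu (v g i))))))"
    unfolding split
  proof (rule sum_mono)
    fix E
    show "(SUP g\<in>G. ennreal (exp (u g + relu (v g k) + (\<Sum>i\<in>A. rademacher E i * relu (v g i))))) +
          (SUP g\<in>G. ennreal (exp (u g - relu (v g k) + (\<Sum>i\<in>A. rademacher E i * relu (v g i)))))
       \<le> (SUP g\<in>G. ennreal (exp (u g + v g k + (\<Sum>i\<in>A. rademacher E i * relu (v g i))))) +
         (SUP g\<in>G. ennreal (exp (u g - v g k + (\<Sum>i\<in>A. rademacher E i * relu (v g i)))))"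
      using relu_contraction_pair[where G = G and u = "\<lambda>g. u g + (\<Sum>i\<in>A. rademacher E i * relu (v g i))"
          and v = "\<lambda>g. v g k"]
      by (simp add: algebra_simps)
  qed
  also have "\<dots> \<le> (\<Sum>E\<in>Pow A. (SUP g\<in>G. ennreal (exp (u g + v g k + (\<Sum>i\<in>A. rademacher E i * v g i)))) +
                  (SUP g\<in>G. ennreal (exp (u g - v g k + (\<Sum>i\<in>A. rademacher E i * v g i)))))"
    using insert.IH[of "\<lambda>g. u g + v g k"] insert.IH[of "\<lambda>g. u g - v g k"]
    by (simp add: sum.distrib add_mono)
  finally show ?case
    unfolding split .
qed simp

lemma relu_mult_nonneg: "0 \<le> c \<Longrightarrow> relu (c * x) = c * relu x"
  by (auto simp: relu_def max_def mult_le_0_iff zero_le_mult_iff not_le)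

lemma sum_Pow_compl:
  assumes "finite A"
  shows "(\<Sum>E\<in>Pow A. F (A - E)) = (\<Sum>E\<in>Pow A. F E)"
  by (rule sum.reindex_bij_witness[where i = "\<lambda>E. A - E" and j = "\<lambda>E. A - E"]) auto

text \<open>Applied under the exponential, removing the absolute value costs a factor 2 per layer, which
  enters the final bound only logarithmically.\<close>

lemma relu_contraction_abs:
  fixes v :: "'g \<Rightarrow> 'i \<Rightarrow> real"
  assumes "finite A" "0 \<le> l"
  shows "(\<Sum>E\<in>Pow A. SUP g\<in>G. ennreal (exp (l * \<bar>\<Sum>i\<in>A. rademacher E i * relu (v g i)\<bar>)))
       \<le> 2 * (\<Sum>E\<in>Pow A. SUP g\<in>G. ennreal (exp (l * (\<Sum>i\<in>A. rademacher E i * v g i))))"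
proof -
  define h where "h E g = (\<Sum>i\<in>A. rademacher E i * relu (v g i))" for E g
  define S where "S E = (SUP g\<in>G. ennreal (exp (l * h E g)))" for E
  \<comment> \<open>The complement reverses all signs, so \<open>exp (l * \<bar>h E g\<bar>)\<close>
    is one of the two exponentials belonging to \<open>E\<close> and \<open>A - E\<close>.\<close>
  have compl: "h (A - E) g = - h E g" for E g
    unfolding h_def by (auto simp: rademacher_def simp flip: sum_negf intro!: sum.cong)
  have "(\<Sum>E\<in>Pow A. SUP g\<in>G. ennreal (exp (l * \<bar>h E g\<bar>))) \<le> (\<Sum>E\<in>Pow A. S E + S (A - E))"
  proof (intro sum_mono SUP_least)
    fix E g assume "g \<in> G"
    then have "ennreal (exp (l * h E g)) \<le> S E" "ennreal (exp (l * h (A - E) g)) \<le> S (A - E)"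
      unfolding S_def by (auto intro: SUP_upper)
    then show "ennreal (exp (l * \<bar>h E g\<bar>)) \<le> S E + S (A - E)"
      unfolding compl by (cases "h E g \<ge> 0") (auto intro: order_trans add_increasing add_increasing2)
  qed
  also have "\<dots> = 2 * (\<Sum>E\<in>Pow A. S E)"
    using sum_Pow_compl[OF assms(1), of S] by (simp add: sum.distrib mult_2)
  also have "(\<Sum>E\<in>Pow A. S E) \<le> (\<Sum>E\<in>Pow A. SUP g\<in>G. ennreal (exp (l * (\<Sum>i\<in>A. rademacher E i * v g i))))"
  proof -
    \<comment> \<open>Positive homogeneity moves \<open>l\<close> inside \<open>relu\<close>, which
      brings the sum into the form of the contraction principle with offset 0.\<close>
    have "S E = (SUP g\<in>G. ennreal (exp (0 + (\<Sum>i\<in>A. rademacher E i * relu (l * v g i)))))" for E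
      unfolding S_def h_def
      by (simp add: relu_mult_nonneg[OF assms(2)] sum_distrib_left mult_ac)
    then show ?thesis
      using relu_contraction[OF assms(1), where G = G and u = "\<lambda>_. 0" and v = "\<lambda>g i. l * v g i"]
      by (simp add: sum_distrib_left mult_ac)
  qed
  finally show ?thesis
    by (simp add: h_def mult_left_mono)
qed

section \<open>The tree-like spaces\<close>

declare tree_norm.simps [simp del]

section \<open>Point evaluations as measurable and integrable functions\<close>

lemma finite_radonD:
  assumes "finite_radon B M"
  shows "sets M = sets (cube_borel B)" "finite_measure M"
  using assms by (auto simp: finite_radon_def)

lemma space_cube_borel_subset: "space (cube_borel B) \<subseteq> B"
  by (auto simp: cube_borel_def cube_topology_def space_measure_of_conv)

lemma finite_radon_space_subset: "finite_radon B M \<Longrightarrow> space M \<subseteq> B"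
  using space_cube_borel_subset[of B] sets_eq_imp_space_eq[OF finite_radonD(1)] by blast

text \<open>Evaluation at a point is 1-Lipschitz for the supremum metric. This makes the integrand
  \<open>relu (g x)\<close> Borel on the balls.\<close>

lemma continuous_map_eval:
  fixes x :: "real ^ 'd"
  assumes x: "x \<in> unit_cube"
  shows "continuous_map (cube_topology B) euclidean (\<lambda>g. g x)"
proof -
  let ?C = "cfunspace (top_of_set (unit_cube :: (real ^ 'd) set)) (euclidean_metric :: real metric)"
  have "Lipschitz_continuous_map ?C euclidean_metric (\<lambda>g. g x)"
    unfolding Lipschitz_continuous_map_def
  proof (intro conjI exI[of _ 1] ballI)
    fix f g assume "f \<in> mspace ?C" "g \<in> mspace ?C"
    then show "mdist euclidean_metric (f x) (g x) \<le> 1 * mdist ?C f g"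
      using x mdist_cfunspace_imp_mdist_le[of f "top_of_set unit_cube" euclidean_metric g "mdist ?C f g" x]
      by (auto simp del: mspace_cfunspace)
  qed auto
  then have "continuous_map (mtopology_of ?C) (mtopology_of (euclidean_metric :: real metric)) (\<lambda>g. g x)"
    by (intro uniformly_continuous_imp_continuous_map Lipschitz_imp_uniformly_continuous_map)
  then show ?thesis
    by (simp add: cube_topology_def continuous_map_from_subtopology)
qed

lemma measurable_eval:
  assumes "x \<in> unit_cube"
  shows "(\<lambda>g. g x) \<in> borel_measurable (cube_borel B)"
proof (rule borel_measurableI)
  fix S :: "real set" assume "open S"
  then have "openin (cube_topology B) {g \<in> topspace (cube_topology B). g x \<in> S}"
    using openin_continuous_map_preimage[OF continuous_map_eval[OF assms, of B], of S] by simp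
  moreover have "{U. openin (cube_topology B) U} \<subseteq> Pow (topspace (cube_topology B))"
    by (auto dest: openin_subset)
  ultimately show "(\<lambda>g. g x) -` S \<inter> space (cube_borel B) \<in> sets (cube_borel B)"
    by (auto simp: cube_borel_def sets_measure_of space_measure_of_conv vimage_def Int_def conj_commute
        intro!: sigma_sets.Basic)
qed

lemma measurable_relu [measurable]: "relu \<in> borel_measurable borel"
  unfolding relu_def [abs_def] by measurable

lemma abs_relu_le: "\<bar>relu a\<bar> \<le> \<bar>a\<bar>"
  by (simp add: relu_def)

lemma measurable_relu_eval:
  assumes "finite_radon B M" "x \<in> unit_cube"
  shows "(\<lambda>g. relu (g x)) \<in> borel_measurable M"
  using measurable_eval[OF assms(2), of B] measurable_cong_sets[OF finite_radonD(1)[OF assms(1)] refl]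
  by (intro measurable_compose[OF _ measurable_relu]) auto

lemma integrable_relu_eval:
  assumes M: "finite_radon B M" and x: "x \<in> unit_cube" and bound: "\<And>g. g \<in> B \<Longrightarrow> \<bar>g x\<bar> \<le> b"
  shows "integrable M (\<lambda>g. relu (g x))"
proof (rule finite_measure.integrable_const_bound[OF finite_radonD(2)[OF M], where B = b])
  show "AE g in M. norm (relu (g x)) \<le> b"
    using finite_radon_space_subset[OF M] abs_relu_le bound
    by (intro AE_I2) (metis order_trans real_norm_def subsetD)
qed (rule measurable_relu_eval[OF M x])

lemma abs_integral_le:
  fixes h :: "'a \<Rightarrow> real"
  assumes "finite_measure M" "\<And>g. g \<in> space M \<Longrightarrow> \<bar>h g\<bar> \<le> m" "integrable M h"
  shows "\<bar>integral\<^sup>L M h\<bar> \<le> m * measure M (space M)"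
proof -
  interpret finite_measure M by fact
  have "\<bar>integral\<^sup>L M h\<bar> \<le> (\<integral>g. \<bar>h g\<bar> \<partial>M)"
    by (rule integral_abs_bound)
  also have "\<dots> \<le> (\<integral>g. m \<partial>M)"
    using assms by (intro integral_mono) auto
  finally show ?thesis
    by (simp add: mult.commute)
qed

text \<open>Norms given by an infimum need not be attained, so estimates are first proved for every
  \<open>s\<close> above the norm. The divisor \<open>m + 1\<close> in the proof admits
  \<open>m = 0\<close>.\<close>

lemma le_mult_if_le_mult_greater:
  fixes m r y :: real
  assumes "\<And>s. r < s \<Longrightarrow> y \<le> m * s" "0 \<le> m"
  shows "y \<le> m * r"
proof (rule field_le_epsilon)
  fix e :: real assume "0 < e"
  then have "y \<le> m * (r + e / (m + 1))"
    using assms by (intro assms(1)) auto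
  also have "\<dots> \<le> m * r + e"
    using \<open>0 < e\<close> assms(2) by (simp add: field_simps)
  finally show "y \<le> m * r + e" .
qed

section \<open>Linear functionals on the balls\<close>

lemma tree_norm_Suc_lessE:
  assumes "tree_norm (Suc L) f < s"
  obtains P N where "signed_radon {g. tree_norm L g \<le> 1} P N" "f = relu_superposition P N" "tv_norm P N < s"
  using assms by (auto simp: tree_norm.simps INF_less_iff)

lemma tree_norm_0_lessE:
  assumes "tree_norm 0 f < s"
  obtains w b where "f = (\<lambda>x\<in>unit_cube. w \<bullet> x + b)" "ennreal ((\<Sum>i\<in>UNIV. \<bar>w $ i\<bar>) + \<bar>b\<bar>) < s"
  using assms by (auto simp: tree_norm.simps INF_less_iff)

lemma tv_norm_less_iff:
  assumes "finite_measure P" "finite_measure N"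
  shows "tv_norm P N < ennreal s \<longleftrightarrow> measure P (space P) + measure N (space N) < s"
  using assms unfolding tv_norm_def
  by (simp add: finite_measure.emeasure_eq_measure ennreal_less_iff flip: ennreal_plus)

text \<open>A linear functional on functions on the cube is controlled on the ball of depth \<open>L + 1\<close> by its
  values at the neurons \<open>relu \<circ> g\<close>, with \<open>g\<close> in the unit ball of depth \<open>L\<close>.\<close>

lemma tree_norm_Suc_functional_le:
  fixes x :: "'i \<Rightarrow> real ^ 'd"
  assumes f: "tree_norm (Suc L) f \<le> ennreal r" and r: "0 \<le> r"
    and A: "finite A" "\<And>i. i \<in> A \<Longrightarrow> x i \<in> unit_cube"
    and bound: "\<And>(g :: real ^ 'd \<Rightarrow> real) x. tree_norm L g \<le> 1 \<Longrightarrow> x \<in> unit_cube \<Longrightarrow> \<bar>g x\<bar> \<le> 1"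
    and m: "\<And>g. tree_norm L g \<le> 1 \<Longrightarrow> \<bar>\<Sum>i\<in>A. a i * relu (g (x i))\<bar> \<le> m" "0 \<le> m"
  shows "\<bar>\<Sum>i\<in>A. a i * f (x i)\<bar> \<le> m * r"
proof (rule le_mult_if_le_mult_greater[OF _ m(2)])
  fix s assume s: "r < s"
  then have "tree_norm (Suc L) f < ennreal s"
    using f r by (meson ennreal_less_iff le_less_trans)
  then obtain P N where PN: "signed_radon {g. tree_norm L g \<le> 1} P N" "f = relu_superposition P N"
      "tv_norm P N < ennreal s"
    by (rule tree_norm_Suc_lessE)
  let ?B = "{g. tree_norm L g \<le> 1} :: (real ^ 'd \<Rightarrow> real) set"
  let ?h = "\<lambda>g. \<Sum>i\<in>A. a i * relu (g (x i))"
  have radon: "finite_radon ?B P" "finite_radon ?B N"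
    using PN(1) by (auto simp: signed_radon_def)
  have int: "integrable M (\<lambda>g. relu (g (x i)))" if "finite_radon ?B M" "i \<in> A" for M i
    using that A(2) by (intro integrable_relu_eval[where b = 1]) (auto intro: bound)
  have eq: "integral\<^sup>L M ?h = (\<Sum>i\<in>A. a i * (LINT g|M. relu (g (x i))))" if "finite_radon ?B M" for M
    using int[OF that] by simp
  have le: "\<bar>integral\<^sup>L M ?h\<bar> \<le> m * measure M (space M)" if M: "finite_radon ?B M" for M
    using int[OF M] finite_radon_space_subset[OF M]
    by (intro abs_integral_le finite_radonD(2)[OF M] m Bochner_Integration.integrable_sum integrable_mult_right) auto
  have "(\<Sum>i\<in>A. a i * f (x i)) = integral\<^sup>L P ?h - integral\<^sup>L N ?h"
    using A(2) unfolding eq[OF radon(1)] eq[OF radon(2)] PN(2) relu_superposition_def sum_subtractf [symmetric]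
    by (intro sum.cong) (auto simp: right_diff_distrib)
  then have "\<bar>\<Sum>i\<in>A. a i * f (x i)\<bar> \<le> \<bar>integral\<^sup>L P ?h\<bar> + \<bar>integral\<^sup>L N ?h\<bar>"
    by simp
  also have "\<dots> \<le> m * (measure P (space P) + measure N (space N))"
    using le[OF radon(1)] le[OF radon(2)] by (simp add: distrib_left)
  also have "\<dots> \<le> m * s"
    using PN(3) m(2) radon[THEN finite_radonD(2)] by (intro mult_left_mono) (auto simp: tv_norm_less_iff)
  finally show "\<bar>\<Sum>i\<in>A. a i * f (x i)\<bar> \<le> m * s" .
qed

text \<open>The affine unit ball is an l1-ball of coefficients, so a functional is controlled by its
  values at the coordinate functions and at the constant 1.\<close>

lemma tree_norm_0_functional_le:
  fixes x :: "'i \<Rightarrow> real ^ 'd"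
  assumes f: "tree_norm 0 f \<le> ennreal r" and r: "0 \<le> r"
    and A: "\<And>i. i \<in> A \<Longrightarrow> x i \<in> unit_cube"
    and m: "\<And>j. \<bar>\<Sum>i\<in>A. a i * x i $ j\<bar> \<le> m" "\<bar>\<Sum>i\<in>A. a i\<bar> \<le> m"
  shows "\<bar>\<Sum>i\<in>A. a i * f (x i)\<bar> \<le> m * r"
proof (rule le_mult_if_le_mult_greater)
  show m0: "0 \<le> m"
    using m(2) by linarith
  fix s assume s: "r < s"
  then have "tree_norm 0 f < ennreal s"
    using f r by (meson ennreal_less_iff le_less_trans)
  then obtain w b where wb: "f = (\<lambda>x\<in>unit_cube. w \<bullet> x + b)" "ennreal ((\<Sum>j\<in>UNIV. \<bar>w $ j\<bar>) + \<bar>b\<bar>) < ennreal s"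
    by (rule tree_norm_0_lessE)
  have less: "(\<Sum>j\<in>UNIV. \<bar>w $ j\<bar>) + \<bar>b\<bar> < s"
    using wb(2) by (subst (asm) ennreal_less_iff) (auto intro!: add_nonneg_nonneg sum_nonneg)
  have "(\<Sum>i\<in>A. a i * f (x i)) = (\<Sum>i\<in>A. (\<Sum>j\<in>UNIV. w $ j * (a i * x i $ j)) + b * a i)"
    using A by (intro sum.cong)
      (auto simp: wb(1) inner_vec_def distrib_left sum_distrib_left mult_ac intro!: sum.cong)
  also have "\<dots> = (\<Sum>j\<in>UNIV. w $ j * (\<Sum>i\<in>A. a i * x i $ j)) + b * (\<Sum>i\<in>A. a i)"
    unfolding sum.distrib by (subst sum.swap) (simp add: sum_distrib_left)
  also have "\<bar>\<dots>\<bar> \<le> (\<Sum>j\<in>UNIV. \<bar>w $ j * (\<Sum>i\<in>A. a i * x i $ j)\<bar>) + \<bar>b * (\<Sum>i\<in>A. a i)\<bar>"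
    by (intro order_trans[OF abs_triangle_ineq] add_right_mono sum_abs)
  also have "\<dots> \<le> (\<Sum>j\<in>UNIV. \<bar>w $ j\<bar> * m) + \<bar>b\<bar> * m"
    using m by (intro add_mono sum_mono) (auto simp: abs_mult intro!: mult_left_mono)
  also have "\<dots> = m * ((\<Sum>j\<in>UNIV. \<bar>w $ j\<bar>) + \<bar>b\<bar>)"
    by (simp add: sum_distrib_left algebra_simps)
  also have "\<dots> \<le> m * s"
    using less m0 by (intro mult_left_mono) auto
  finally show "\<bar>\<Sum>i\<in>A. a i * f (x i)\<bar> \<le> m * s" .
qed

lemma unit_cube_component: "x \<in> unit_cube \<Longrightarrow> 0 \<le> x $ j \<and> x $ j \<le> 1"
  by (simp add: mem_box_cart)

lemma relu_lipschitz: "\<bar>relu a - relu b\<bar> \<le> \<bar>a - b\<bar>"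
  by (auto simp: relu_def)

text \<open>Both bounds are instances of the functional estimates, applied to an evaluation and to a
  difference of two evaluations. The Lipschitz constant does not grow with the depth because
  \<open>relu\<close> is 1-Lipschitz.\<close>

lemma tree_norm_bounds:
  fixes f :: "real ^ 'd \<Rightarrow> real"
  assumes "tree_norm L f \<le> ennreal r" "0 \<le> r"
  shows "\<forall>x\<in>unit_cube. \<bar>f x\<bar> \<le> r" "\<forall>x\<in>unit_cube. \<forall>y\<in>unit_cube. \<bar>f x - f y\<bar> \<le> r * dist x y"
proof -
  have "(\<forall>x\<in>unit_cube. \<bar>f x\<bar> \<le> r) \<and> (\<forall>x\<in>unit_cube. \<forall>y\<in>unit_cube. \<bar>f x - f y\<bar> \<le> r * dist x y)"
    using assms
  proof (induction L arbitrary: f r)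
    case 0
    show ?case
    proof (intro conjI ballI)
      fix x :: "real ^ 'd" assume x: "x \<in> unit_cube"
      show "\<bar>f x\<bar> \<le> r"
        using tree_norm_0_functional_le[OF 0, of "{()}" "\<lambda>_. x" "\<lambda>_. 1" 1] x unit_cube_component[OF x]
        by simp
      fix y :: "real ^ 'd" assume y: "y \<in> unit_cube"
      show "\<bar>f x - f y\<bar> \<le> r * dist x y"
        \<comment> \<open>The index set \<open>bool\<close> carries \<open>f x - f y\<close>; the
          coefficients sum to 0, so only coordinate differences contribute, each at most
          \<open>dist x y\<close>.\<close>
        using tree_norm_0_functional_le[OF 0, of UNIV "\<lambda>i. if i then x else y" "\<lambda>i. if i then 1 else -1" "dist x y"]
          x y component_le_norm_cart[of "x - y"]
        by (simp add: UNIV_bool dist_norm mult.commute)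
    qed
  next
    case (Suc L)
    have IH: "\<bar>g x\<bar> \<le> 1" "\<bar>g x - g y\<bar> \<le> dist x y"
      if "tree_norm L g \<le> 1" "x \<in> unit_cube" "y \<in> unit_cube" for g :: "real ^ 'd \<Rightarrow> real" and x y
      using Suc.IH[of g 1] that by auto
    show ?case
    proof (intro conjI ballI)
      fix x :: "real ^ 'd" assume x: "x \<in> unit_cube"
      have *: "\<bar>relu (g x)\<bar> \<le> 1" if "tree_norm L g \<le> 1" for g :: "real ^ 'd \<Rightarrow> real"
        using IH(1)[OF that x x] abs_relu_le[of "g x"] by linarith
      show "\<bar>f x\<bar> \<le> r"
        using tree_norm_Suc_functional_le[OF Suc.prems, of "{()}" "\<lambda>_. x" "\<lambda>_. 1" 1] x IH(1) * by simp
      fix y :: "real ^ 'd" assume y: "y \<in> unit_cube"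
      have "\<bar>relu (g x) - relu (g y)\<bar> \<le> dist x y" if "tree_norm L g \<le> 1" for g
        using IH(2)[OF that x y] relu_lipschitz[of "g x" "g y"] by linarith
      then show "\<bar>f x - f y\<bar> \<le> r * dist x y"
        using tree_norm_Suc_functional_le[OF Suc.prems, of UNIV "\<lambda>i. if i then x else y" "\<lambda>i. if i then 1 else -1" "dist x y"]
          x y IH(1)
        by (simp add: UNIV_bool mult.commute)
    qed
  qed
  then show "\<forall>x\<in>unit_cube. \<bar>f x\<bar> \<le> r" "\<forall>x\<in>unit_cube. \<forall>y\<in>unit_cube. \<bar>f x - f y\<bar> \<le> r * dist x y"
    by auto
qed

section \<open>Extensionality, the zero function and homogeneity\<close>

lemma tree_norm_extensional:
  assumes "tree_norm L f < \<top>"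
  shows "f \<in> extensional unit_cube"
proof (cases L)
  case 0
  with assms show ?thesis
    by (auto elim: tree_norm_0_lessE)
next
  case (Suc n)
  with assms show ?thesis
    by (auto elim: tree_norm_Suc_lessE simp: relu_superposition_def)
qed

text \<open>Makes every unit ball nonempty, which later keeps suprema of exponentials at least 1.
  From depth 1 on, zero is represented by a pair of null measures.\<close>

lemma tree_norm_zero: "tree_norm L (\<lambda>x\<in>unit_cube :: (real ^ 'd) set. 0) = 0"
proof (cases L)
  case 0
  have "tree_norm 0 (\<lambda>x\<in>unit_cube :: (real ^ 'd) set. 0) \<le> ennreal ((\<Sum>i\<in>UNIV. \<bar>(0 :: real ^ 'd) $ i\<bar>) + \<bar>0\<bar>)"
    unfolding tree_norm.simps by (rule INF_lower2[of "(0, 0)"]) auto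
  then show ?thesis
    using 0 by simp
next
  case (Suc n)
  let ?B = "{g. tree_norm n g \<le> 1} :: (real ^ 'd \<Rightarrow> real) set"
  let ?M = "null_measure (cube_borel ?B)"
  have "finite_radon ?B ?M"
  proof -
    have "(SUP K\<in>{K. K \<subseteq> A \<and> compactin (cube_topology ?B) K}. emeasure ?M K) = 0" for A
      by (intro antisym SUP_least) auto
    then show ?thesis
      by (auto simp: finite_radon_def intro!: finite_measureI)
  qed
  then have "signed_radon ?B ?M ?M"
    by (auto simp: signed_radon_def intro!: bexI[of _ "{}"])
  moreover have "(\<lambda>x\<in>unit_cube. 0) = relu_superposition ?M ?M"
    by (simp add: relu_superposition_def)
  ultimately have "tree_norm (Suc n) (\<lambda>x\<in>unit_cube :: (real ^ 'd) set. 0) \<le> tv_norm ?M ?M"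
    unfolding tree_norm.simps by (intro INF_lower2[of "(?M, ?M)"]) auto
  then show ?thesis
    using Suc by (simp add: tv_norm_def)
qed

lemma scale_measure_eq_density: "scale_measure (ennreal a) M = density M (\<lambda>_. ennreal a)"
  by (rule measure_eqI) (auto simp: emeasure_density nn_integral_cmult)

lemma integral_scale_measure:
  fixes f :: "'a \<Rightarrow> real"
  assumes "f \<in> borel_measurable M" "0 \<le> a"
  shows "integral\<^sup>L (scale_measure (ennreal a) M) f = a * integral\<^sup>L M f"
  unfolding scale_measure_eq_density using assms by (subst integral_real_density) auto

lemma finite_radon_scale_measure:
  assumes "finite_radon B M"
  shows "finite_radon B (scale_measure (ennreal a) M)"
proof -
  have "emeasure M (space M) \<noteq> \<infinity>"
    using finite_radonD(2)[OF assms] by (simp add: finite_measure.emeasure_finite)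
  then have "finite_measure (scale_measure (ennreal a) M)"
    by (intro finite_measureI) (simp add: space_scale_measure ennreal_mult_eq_top_iff)
  then show ?thesis
    using assms by (simp add: finite_radon_def SUP_mult_left_ennreal)
qed

text \<open>The strict bound supplies a representing pair. Scaling both of its measures by the same
  \<open>a > 0\<close> preserves regularity and the separating set, hence the Jordan form.\<close>

lemma tree_norm_scale_aux:
  fixes f :: "real ^ 'd \<Rightarrow> real"
  assumes f: "tree_norm L f < ennreal s" and a: "0 < a"
  shows "tree_norm L (\<lambda>x\<in>unit_cube. a * f x) \<le> ennreal (a * s)"
proof (cases L)
  case 0
  then obtain w b where wb: "f = (\<lambda>x\<in>unit_cube. w \<bullet> x + b)" "ennreal ((\<Sum>j\<in>UNIV. \<bar>w $ j\<bar>) + \<bar>b\<bar>) < ennreal s"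
    using f by (auto elim: tree_norm_0_lessE)
  have less: "(\<Sum>j\<in>UNIV. \<bar>w $ j\<bar>) + \<bar>b\<bar> < s"
    using wb(2) by (subst (asm) ennreal_less_iff) (auto intro!: add_nonneg_nonneg sum_nonneg)
  have "tree_norm 0 (\<lambda>x\<in>unit_cube. a * f x) \<le> ennreal ((\<Sum>j\<in>UNIV. \<bar>(a *\<^sub>R w) $ j\<bar>) + \<bar>a * b\<bar>)"
    unfolding tree_norm.simps
    by (rule INF_lower2[of "(a *\<^sub>R w, a * b)"]) (auto simp: wb(1) distrib_left)
  also have "\<dots> = ennreal (a * ((\<Sum>j\<in>UNIV. \<bar>w $ j\<bar>) + \<bar>b\<bar>))"
    using a by (simp add: abs_mult sum_distrib_left distrib_left)
  also have "\<dots> \<le> ennreal (a * s)"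
    using less a by (intro ennreal_leI mult_left_mono) auto
  finally show ?thesis
    using 0 by simp
next
  case (Suc n)
  let ?B = "{g. tree_norm n g \<le> 1} :: (real ^ 'd \<Rightarrow> real) set"
  from f Suc obtain P N where PN: "signed_radon ?B P N" "f = relu_superposition P N" "tv_norm P N < ennreal s"
    by (auto elim: tree_norm_Suc_lessE)
  let ?P = "scale_measure (ennreal a) P" and ?N = "scale_measure (ennreal a) N"
  have radon: "finite_radon ?B P" "finite_radon ?B N"
    using PN(1) by (auto simp: signed_radon_def)
  have "signed_radon ?B ?P ?N"
    using PN(1) finite_radon_scale_measure[OF radon(1)] finite_radon_scale_measure[OF radon(2)]
    by (auto simp: signed_radon_def space_scale_measure)
  moreover have "(\<lambda>x\<in>unit_cube. a * f x) = relu_superposition ?P ?N"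
    using a radon[THEN measurable_relu_eval] unfolding PN(2) relu_superposition_def
    by (auto simp: fun_eq_iff restrict_def integral_scale_measure right_diff_distrib)
  ultimately have "tree_norm (Suc n) (\<lambda>x\<in>unit_cube. a * f x) \<le> tv_norm ?P ?N"
    unfolding tree_norm.simps by (intro INF_lower2[of "(?P, ?N)"]) auto
  also have "\<dots> = ennreal a * tv_norm P N"
    by (simp add: tv_norm_def space_scale_measure distrib_left)
  also have "\<dots> \<le> ennreal a * ennreal s"
    using PN(3) by (intro mult_left_mono) auto
  also have "\<dots> = ennreal (a * s)"
    using a by (simp add: ennreal_mult')
  finally show ?thesis
    using Suc by simp
qed

lemma tree_norm_scale:
  assumes f: "tree_norm L f \<le> ennreal r" and a: "0 < a" and r: "0 \<le> r"
  shows "tree_norm L (\<lambda>x\<in>unit_cube. a * f x) \<le> ennreal (a * r)"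
proof (rule ennreal_le_epsilon)
  fix e :: real assume "0 < e"
  then have "ennreal r < ennreal (r + e / a)"
    using a r by (simp add: ennreal_less_iff)
  then have "tree_norm L (\<lambda>x\<in>unit_cube. a * f x) \<le> ennreal (a * (r + e / a))"
    using f by (intro tree_norm_scale_aux a) auto
  also have "\<dots> = ennreal (a * r) + ennreal e"
    using a r \<open>0 < e\<close> by (simp add: distrib_left flip: ennreal_plus)
  finally show "tree_norm L (\<lambda>x\<in>unit_cube. a * f x) \<le> ennreal (a * r) + ennreal e" .
qed

section \<open>Rademacher complexity of the tree-like spaces\<close>

abbreviation tree_unit :: "nat \<Rightarrow> (real ^ 'd \<Rightarrow> real) set" where
  "tree_unit L \<equiv> {f. tree_norm L f \<le> 1}"

lemma tree_unit_bounds: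
  assumes "tree_norm L f \<le> 1" "x \<in> unit_cube" "y \<in> unit_cube"
  shows "\<bar>f x\<bar> \<le> 1" "\<bar>f x - f y\<bar> \<le> dist x y"
  using tree_norm_bounds[of L f 1] assms by auto

text \<open>A finite right-hand side \<open>M\<close> says that every neuron has functional value at
  most \<open>ln M / l\<close> in modulus. This bound passes to the ball of depth
  \<open>L + 1\<close> and is exponentiated again.\<close>

lemma tree_mgf_Suc_le:
  fixes x :: "'i \<Rightarrow> real ^ 'd"
  assumes A: "finite A" "\<And>i. i \<in> A \<Longrightarrow> x i \<in> unit_cube" and l: "0 < l"
  shows "(SUP f\<in>tree_unit (Suc L). ennreal (exp (l * (\<Sum>i\<in>A. a i * f (x i)))))
       \<le> (SUP g\<in>tree_unit L. ennreal (exp (l * \<bar>\<Sum>i\<in>A. a i * relu (g (x i))\<bar>)))" (is "_ \<le> ?M")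
proof (cases "?M = \<top>")
  case False
  define M where "M = enn2real ?M"
  have MM: "?M = ennreal M"
    using False by (simp only: M_def less_top ennreal_enn2real)
  have le: "exp (l * \<bar>\<Sum>i\<in>A. a i * relu (g (x i))\<bar>) \<le> M" if "tree_norm L g \<le> 1" for g
  proof -
    have "ennreal (exp (l * \<bar>\<Sum>i\<in>A. a i * relu (g (x i))\<bar>)) \<le> ?M"
      using that by (intro SUP_upper) auto
    also note MM
    finally show ?thesis
      by (subst (asm) ennreal_le_iff) (auto simp: M_def)
  qed
  \<comment> \<open>The zero function gives \<open>1 \<le> M\<close>, so \<open>ln M / l\<close> is
    nonnegative as the functional estimate demands.\<close>
  have "tree_norm L (\<lambda>x\<in>unit_cube :: (real ^ 'd) set. 0) \<le> 1"
    by (simp add: tree_norm_zero)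
  from le[OF this] have "exp 0 \<le> M"
    by (rule order_trans [rotated]) (use l in simp)
  then have M1: "1 \<le> M"
    by simp
  have m: "\<bar>\<Sum>i\<in>A. a i * relu (g (x i))\<bar> \<le> ln M / l" if "tree_norm L g \<le> 1" for g
  proof -
    have "l * \<bar>\<Sum>i\<in>A. a i * relu (g (x i))\<bar> \<le> ln M"
      using le[OF that] M1 by (subst ln_ge_iff) auto
    then show ?thesis
      using l by (simp add: field_simps)
  qed
  show ?thesis
  proof (rule SUP_least)
    fix f :: "real ^ 'd \<Rightarrow> real" assume "f \<in> tree_unit (Suc L)"
    then have "\<bar>\<Sum>i\<in>A. a i * f (x i)\<bar> \<le> ln M / l * 1"
      using A m M1 l tree_unit_bounds(1)
      by (intro tree_norm_Suc_functional_le[where L = L]) auto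
    then have "l * (\<Sum>i\<in>A. a i * f (x i)) \<le> ln M"
      using l by (simp add: field_simps abs_le_iff)
    then have "exp (l * (\<Sum>i\<in>A. a i * f (x i))) \<le> M"
      using M1 by (subst (asm) ln_ge_iff) auto
    then have "ennreal (exp (l * (\<Sum>i\<in>A. a i * f (x i)))) \<le> ennreal M"
      by (rule ennreal_leI)
    then show "ennreal (exp (l * (\<Sum>i\<in>A. a i * f (x i)))) \<le> ?M"
      by (simp only: MM)
  qed
qed (simp only: top_greatest)

text \<open>The functional is at most its largest modulus over the coordinate functions and the
  constant 1. The exponential of that maximum is bounded by the sum over both signs of each, which
  is the origin of the count \<open>2 * d + 2\<close>.\<close>

lemma tree_mgf_0_le:
  fixes x :: "'i \<Rightarrow> real ^ 'd"
  assumes A: "\<And>i. i \<in> A \<Longrightarrow> x i \<in> unit_cube" and l: "0 < l"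
    and f: "tree_norm 0 (f :: real ^ 'd \<Rightarrow> real) \<le> 1"
  shows "exp (l * (\<Sum>i\<in>A. a i * f (x i))) \<le>
    (\<Sum>j\<in>UNIV. exp (\<Sum>i\<in>A. a i * (l * x i $ j)) + exp (\<Sum>i\<in>A. a i * - (l * x i $ j))) +
    (exp (\<Sum>i\<in>A. a i * l) + exp (\<Sum>i\<in>A. a i * - l))" (is "_ \<le> ?T")
proof -
  let ?e = "\<lambda>z. exp z + exp (- z)"
  have e: "exp \<bar>z\<bar> \<le> ?e z" for z :: real
    by (cases "z \<ge> 0") auto
  define Z where "Z j = (\<Sum>i\<in>A. a i * x i $ j)" for j
  define Z0 where "Z0 = (\<Sum>i\<in>A. a i)"
  have T: "?T = (\<Sum>j\<in>UNIV. ?e (l * Z j)) + ?e (l * Z0)"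
    by (simp add: Z_def Z0_def sum_distrib_left sum_negf mult_ac)
  have pos: "0 < ?T"
    unfolding T by (intro add_nonneg_pos sum_nonneg) (auto simp: add_pos_pos less_imp_le)
  have ln: "\<bar>z\<bar> \<le> ln ?T / l" if "?e (l * z) \<le> ?T" for z
  proof -
    have "exp (l * \<bar>z\<bar>) \<le> ?T"
      using e[of "l * z"] that l by (simp add: abs_mult)
    then have "l * \<bar>z\<bar> \<le> ln ?T"
      using pos by (subst ln_ge_iff)
    then show ?thesis
      using l by (simp add: field_simps)
  qed
  have "\<bar>Z j\<bar> \<le> ln ?T / l" for j
  proof (rule ln)
    have "?e (l * Z j) \<le> (\<Sum>j\<in>UNIV. ?e (l * Z j))"
      by (rule member_le_sum) (auto simp: add_nonneg_nonneg)
    then show "?e (l * Z j) \<le> ?T"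
      unfolding T by (meson add_increasing2 add_nonneg_nonneg exp_ge_zero)
  qed
  moreover have "\<bar>Z0\<bar> \<le> ln ?T / l"
  proof (rule ln)
    have "0 \<le> (\<Sum>j\<in>UNIV. ?e (l * Z j))"
      by (intro sum_nonneg) (auto simp: add_nonneg_nonneg)
    then show "?e (l * Z0) \<le> ?T"
      unfolding T by linarith
  qed
  ultimately have "\<bar>\<Sum>i\<in>A. a i * f (x i)\<bar> \<le> ln ?T / l * 1"
    using f A by (intro tree_norm_0_functional_le) (auto simp: Z_def Z0_def)
  then have "l * (\<Sum>i\<in>A. a i * f (x i)) \<le> ln ?T"
    using l by (simp add: field_simps abs_le_iff)
  then show ?thesis
    using pos by (subst (asm) ln_ge_iff)
qed

text \<open>The \<open>2 * CARD('d) + 2\<close> exponentials of the affine case have coefficients at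
  most \<open>l\<close> in modulus, since the points lie in the cube. Each further layer costs a
  factor 2.\<close>

lemma tree_mgf_le:
  fixes x :: "'i \<Rightarrow> real ^ 'd" and l :: real
  assumes A: "finite A" "\<And>i. i \<in> A \<Longrightarrow> x i \<in> unit_cube" and l: "0 < l"
  shows "(\<Sum>E\<in>Pow A. SUP f\<in>tree_unit L. ennreal (exp (l * (\<Sum>i\<in>A. rademacher E i * f (x i)))))
       \<le> ennreal (2 ^ L * (2 * real CARD('d) + 2) * (2 ^ card A * exp (card A * l\<^sup>2 / 2)))"
proof (induction L)
  case 0
  let ?K = "2 ^ card A * exp (card A * l\<^sup>2 / 2)"
  have K: "(\<Sum>E\<in>Pow A. exp (\<Sum>i\<in>A. rademacher E i * z i)) \<le> ?K" if "\<And>i. i \<in> A \<Longrightarrow> \<bar>z i\<bar> \<le> l" for z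
  proof -
    have "(\<Sum>i\<in>A. (z i)\<^sup>2) \<le> (\<Sum>i\<in>A. l\<^sup>2)"
      using that l by (intro sum_mono) (metis abs_ge_zero abs_le_square_iff abs_of_pos)
    then show ?thesis
      by (intro order_trans[OF rademacher_mgf[OF A(1)]] mult_left_mono) auto
  qed
  have *: "\<bar>l * x i $ j\<bar> \<le> l" if "i \<in> A" for i j
    using unit_cube_component[OF A(2)[OF that], of j] l by (simp add: abs_mult)
  let ?T = "\<lambda>E. (\<Sum>j\<in>UNIV. exp (\<Sum>i\<in>A. rademacher E i * (l * x i $ j)) + exp (\<Sum>i\<in>A. rademacher E i * - (l * x i $ j))) +
    (exp (\<Sum>i\<in>A. rademacher E i * l) + exp (\<Sum>i\<in>A. rademacher E i * - l))"
  have "(\<Sum>E\<in>Pow A. SUP f\<in>tree_unit 0. ennreal (exp (l * (\<Sum>i\<in>A. rademacher E i * f (x i)))))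
      \<le> (\<Sum>E\<in>Pow A. ennreal (?T E))"
    using tree_mgf_0_le[where x = x and l = l and A = A] A(2) l
    by (intro sum_mono SUP_least ennreal_leI) auto
  also have "\<dots> = ennreal (\<Sum>E\<in>Pow A. ?T E)"
    by (intro sum_ennreal) (auto intro!: add_nonneg_nonneg sum_nonneg)
  also have "(\<Sum>E\<in>Pow A. ?T E) =
      (\<Sum>j\<in>UNIV. (\<Sum>E\<in>Pow A. exp (\<Sum>i\<in>A. rademacher E i * (l * x i $ j))) +
                 (\<Sum>E\<in>Pow A. exp (\<Sum>i\<in>A. rademacher E i * - (l * x i $ j)))) +
      ((\<Sum>E\<in>Pow A. exp (\<Sum>i\<in>A. rademacher E i * l)) + (\<Sum>E\<in>Pow A. exp (\<Sum>i\<in>A. rademacher E i * - l)))"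
    unfolding sum.distrib by (simp only: sum.swap[of _ _ "Pow A"])
  also have "\<dots> \<le> (\<Sum>j\<in>(UNIV :: 'd set). ?K + ?K) + (?K + ?K)"
    by (intro add_mono sum_mono K) (use l in \<open>auto intro: *\<close>)
  also have "\<dots> = 2 ^ 0 * (2 * real CARD('d) + 2) * ?K"
    by (simp add: algebra_simps)
  finally show ?case
    by (simp add: ennreal_leI)
next
  case (Suc L)
  have "(\<Sum>E\<in>Pow A. SUP f\<in>tree_unit (Suc L). ennreal (exp (l * (\<Sum>i\<in>A. rademacher E i * f (x i)))))
      \<le> (\<Sum>E\<in>Pow A. SUP g\<in>tree_unit L. ennreal (exp (l * \<bar>\<Sum>i\<in>A. rademacher E i * relu (g (x i))\<bar>)))"
    using A l by (intro sum_mono tree_mgf_Suc_le)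
  also have "\<dots> \<le> 2 * (\<Sum>E\<in>Pow A. SUP g\<in>tree_unit L. ennreal (exp (l * (\<Sum>i\<in>A. rademacher E i * g (x i)))))"
    using A(1) l by (intro relu_contraction_abs) auto
  also have "\<dots> \<le> 2 * ennreal (2 ^ L * (2 * real CARD('d) + 2) * (2 ^ card A * exp (card A * l\<^sup>2 / 2)))"
    by (intro mult_left_mono Suc.IH) auto
  also have "\<dots> = ennreal (2 * (2 ^ L * (2 * real CARD('d) + 2) * (2 ^ card A * exp (card A * l\<^sup>2 / 2))))"
    by (simp add: ennreal_mult)
  finally show ?case
    by (simp only: power_Suc mult.assoc)
qed

definition tree_log :: "'d::finite itself \<Rightarrow> nat \<Rightarrow> real" where
  "tree_log TYPE('d) L = L * ln 2 + ln (2 * real CARD('d) + 2)"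

lemma exp_tree_log: "exp (tree_log TYPE('d::finite) L) = 2 ^ L * (2 * real CARD('d) + 2)"
  by (simp add: tree_log_def exp_add exp_of_nat_mult add_pos_pos)

lemma tree_log_ge_1: "1 \<le> tree_log TYPE('d::finite) L"
proof -
  have "exp 1 \<le> (4 :: real)"
    using exp_le by linarith
  also have "4 \<le> 2 * real CARD('d) + 2"
    by (simp add: Suc_leI)
  finally have "1 \<le> ln (2 * real CARD('d) + 2)"
    by (subst ln_ge_iff) auto
  moreover have "0 \<le> real L * ln 2"
    by simp
  ultimately show ?thesis
    unfolding tree_log_def by linarith
qed

text \<open>Jensen's inequality for the logarithm in the linearised form \<open>l y \<le> k' - 1 + exp (l y - k')\<close>, with
  the value \<open>k'\<close> of the logarithm of the averaged exponential and the optimal \<open>l\<close>.\<close>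

lemma tree_rademacher_le:
  fixes x :: "'i \<Rightarrow> real ^ 'd"
  assumes A: "finite A" "A \<noteq> {}" "\<And>i. i \<in> A \<Longrightarrow> x i \<in> unit_cube"
  shows "(\<Sum>E\<in>Pow A. SUP f\<in>tree_unit L. ennreal (\<Sum>i\<in>A. rademacher E i * f (x i)))
       \<le> ennreal (2 ^ card A * sqrt (2 * card A * tree_log TYPE('d) L))"
proof -
  define n where "n = card A"
  define k where "k = tree_log TYPE('d) L"
  \<comment> \<open>Minimises \<open>k / l + n * l / 2\<close>: the two terms coincide, so
    \<open>k' = 2 * k\<close> and \<open>k' / l = n * l = sqrt (2 * n * k)\<close>.\<close>
  define l where "l = sqrt (2 * k / n)"
  define k' where "k' = k + n * l\<^sup>2 / 2"
  have n: "n > 0" and k: "k \<ge> 1"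
    using A tree_log_ge_1 by (auto simp: n_def k_def card_gt_0_iff)
  have l: "l > 0" "l\<^sup>2 = 2 * k / n"
    using n k by (auto simp: l_def)
  \<comment> \<open>With \<open>k' \<ge> 1\<close> the constant \<open>(k' - 1) / l\<close> is
    nonnegative and survives the passage to \<open>ennreal\<close>.\<close>
  have k': "k' = 2 * k" "k' \<ge> 1"
    using l n k by (auto simp: k'_def)
  have *: "ennreal y \<le> ennreal ((k' - 1) / l) + ennreal (exp (- k') / l) * ennreal (exp (l * y))" for y
  proof -
    have "1 + (l * y - k') \<le> exp (l * y - k')"
      by (rule exp_ge_add_one_self)
    then have "y \<le> (k' - 1 + exp (l * y - k')) / l"
      unfolding pos_le_divide_eq[OF l(1)] mult.commute[of y] by linarith
    also have "\<dots> = (k' - 1) / l + exp (- k') / l * exp (l * y)"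
      by (simp add: add_divide_distrib exp_diff exp_minus divide_inverse algebra_simps)
    finally have "y \<le> (k' - 1) / l + exp (- k') / l * exp (l * y)" .
    then have "ennreal y \<le> ennreal ((k' - 1) / l + exp (- k') / l * exp (l * y))"
      by (rule ennreal_leI)
    also have "\<dots> = ennreal ((k' - 1) / l) + ennreal (exp (- k') / l) * ennreal (exp (l * y))"
      using k' l(1) by (simp flip: ennreal_mult ennreal_plus)
    finally show ?thesis .
  qed
  have "(\<Sum>E\<in>Pow A. SUP f\<in>tree_unit L. ennreal (\<Sum>i\<in>A. rademacher E i * f (x i)))
      \<le> (\<Sum>E\<in>Pow A. ennreal ((k' - 1) / l) + ennreal (exp (- k') / l) *
            (SUP f\<in>tree_unit L. ennreal (exp (l * (\<Sum>i\<in>A. rademacher E i * f (x i))))))"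
    by (intro sum_mono SUP_least order_trans[OF *] add_left_mono mult_left_mono SUP_upper) auto
  also have "\<dots> = of_nat (2 ^ n) * ennreal ((k' - 1) / l) + ennreal (exp (- k') / l) *
      (\<Sum>E\<in>Pow A. SUP f\<in>tree_unit L. ennreal (exp (l * (\<Sum>i\<in>A. rademacher E i * f (x i)))))"
    using A(1) by (simp add: sum.distrib sum_distrib_left card_Pow n_def)
  also have "\<dots> \<le> of_nat (2 ^ n) * ennreal ((k' - 1) / l) + ennreal (exp (- k') / l) *
      ennreal (2 ^ L * (2 * real CARD('d) + 2) * (2 ^ card A * exp (card A * l\<^sup>2 / 2)))"
    using A l by (intro add_left_mono mult_left_mono tree_mgf_le) auto
  also have "2 ^ L * (2 * real CARD('d) + 2) * (2 ^ card A * exp (card A * l\<^sup>2 / 2)) = 2 ^ n * exp k'"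
    using exp_tree_log[where 'd = 'd, of L] by (simp add: k'_def exp_add k_def n_def)
  also have "of_nat (2 ^ n) * ennreal ((k' - 1) / l) + ennreal (exp (- k') / l) * ennreal (2 ^ n * exp k') =
      ennreal (2 ^ n * ((k' - 1) / l) + exp (- k') / l * (2 ^ n * exp k'))"
    unfolding ennreal_of_nat_eq_real_of_nat using k' l(1) by (simp flip: ennreal_mult ennreal_plus)
  also have "2 ^ n * ((k' - 1) / l) + exp (- k') / l * (2 ^ n * exp k') = 2 ^ n * (k' / l)"
    using l(1) by (simp add: exp_minus field_simps)
  also have "k' / l = sqrt (2 * n * k)"
  proof -
    have "k' = n * l * l"
      using l(2) n by (simp add: k' power2_eq_square mult.assoc)
    then have "k' / l = n * l"
      using l(1) by simp
    also have "(n * l)\<^sup>2 = 2 * n * k"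
      unfolding power_mult_distrib l(2) using n by (simp add: power2_eq_square)
    then have "n * l = sqrt (2 * n * k)"
      using l(1) by (intro real_sqrt_unique [symmetric]) auto
    finally show ?thesis .
  qed
  finally show ?thesis
    by (simp add: n_def k_def)
qed

section \<open>The Monte-Carlo estimate\<close>

lemma emeasure_unit_cube: "emeasure lborel (unit_cube :: (real ^ 'd) set) = 1"
proof -
  have *: "(1 :: real ^ 'd) \<bullet> b = 1" if "b \<in> Basis" for b
    using that by (auto simp: Basis_vec_def inner_axis)
  have "emeasure lborel (unit_cube :: (real ^ 'd) set) = (\<Prod>b\<in>(Basis :: (real ^ 'd) set). 1 \<bullet> b)"
    by (subst emeasure_lborel_cbox_eq) (simp add: *)
  also have "\<dots> = 1" using * by (simp add: prod.neutral)
  finally show ?thesis .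
qed

abbreviation cube_uniform :: "(real ^ 'd) measure" where
  "cube_uniform \<equiv> uniform_measure lborel unit_cube"

lemma prob_space_cube_uniform: "prob_space cube_uniform"
  by (rule prob_space_uniform_measure) (simp_all add: emeasure_unit_cube)

lemma AE_cube_uniform: "AE x in cube_uniform. x \<in> unit_cube"
  by (rule AE_uniform_measureI) auto

lemma borel_measurable_cube_uniform: "borel_measurable (cube_uniform :: (real ^ 'd) measure) = borel_measurable borel"
  by (rule measurable_cong_sets) simp_all

lemma integral_cube_uniform:
  fixes f :: "real ^ 'd \<Rightarrow> real"
  assumes [measurable]: "f \<in> borel_measurable borel"
  shows "integral\<^sup>L cube_uniform f = (LINT y:unit_cube|lebesgue. f y)"
proof -
  have "(\<lambda>x :: real ^ 'd. indicator unit_cube x / emeasure lborel (unit_cube :: (real ^ 'd) set)) = (\<lambda>x. ennreal (indicator unit_cube x))"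
    by (simp add: emeasure_unit_cube divide_ennreal_def ennreal_indicator)
  then have "cube_uniform = density lborel (\<lambda>x :: real ^ 'd. ennreal (indicator unit_cube x))"
    by (simp only: uniform_measure_def)
  then have "integral\<^sup>L cube_uniform f = integral\<^sup>L lborel (\<lambda>x. indicator unit_cube x * f x)"
    by (simp add: integral_real_density)
  then show ?thesis
    by (simp add: set_lebesgue_integral_def integral_completion)
qed

text \<open>Off the cube an extensional function is the constant \<open>undefined\<close>, so
  continuity on the cube yields Borel measurability on the whole space.\<close>

lemma tree_unit_measurable:
  fixes f :: "real ^ 'd \<Rightarrow> real"
  assumes "f \<in> tree_unit L"
  shows "f \<in> borel_measurable borel"
proof -
  have "1-lipschitz_on unit_cube f"
    using tree_unit_bounds(2)[of L f] assms by (intro lipschitz_onI) (auto simp: dist_real_def)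
  then have cont: "continuous_on unit_cube f"
    by (rule lipschitz_on_continuous_on)
  have meas: "(\<lambda>x. if x \<in> unit_cube then f x else undefined) \<in> borel_measurable borel"
    by (rule borel_measurable_continuous_on_if[OF _ cont continuous_on_const]) simp
  have f_ext: "f \<in> extensional unit_cube"
    using assms le_less_trans[of "tree_norm L f" 1 \<top>] by (intro tree_norm_extensional[of L]) simp
  have eq: "(\<lambda>x. if x \<in> unit_cube then f x else undefined) = f"
    by (rule ext) (simp add: extensional_arb[OF f_ext])
  show ?thesis
    by (rule back_subst[where P = "\<lambda>g. g \<in> borel_measurable borel", OF meas eq])
qed

lemma tree_unit_integrable:
  fixes f :: "real ^ 'd \<Rightarrow> real"
  assumes "f \<in> tree_unit L"
  shows "integrable cube_uniform f"
proof -
  interpret prob_space "cube_uniform :: (real ^ 'd) measure"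
    by (rule prob_space_cube_uniform)
  have "norm (f x) \<le> 1" if "x \<in> unit_cube" for x
    using assms that tree_unit_bounds(1)[of L f x x] by simp
  then have "AE x in cube_uniform. norm (f x) \<le> 1"
    by (rule eventually_mono[OF AE_cube_uniform])
  then show ?thesis
    using tree_unit_measurable[OF assms] unfolding borel_measurable_cube_uniform [symmetric]
    by (rule integrable_const_bound)
qed

text \<open>Equi-Lipschitz functions that converge on a dense set converge everywhere; hence the separability of
  the countable product of real lines suffices.\<close>

lemma tree_unit_separable:
  obtains D :: "(real ^ 'd \<Rightarrow> real) set" where "countable D" "D \<subseteq> tree_unit L"
    "\<And>f. f \<in> tree_unit L \<Longrightarrow> \<exists>h. (\<forall>k::nat. h k \<in> D) \<and> (\<forall>x. (\<lambda>k. h k x) \<longlonglongrightarrow> f x)"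
proof -
  obtain Q :: "(real ^ 'd) set" where Q: "countable Q" "Q \<subseteq> unit_cube" "unit_cube \<subseteq> closure Q"
    by (rule separable)
  have "(0 :: real ^ 'd) \<in> unit_cube"
    by (simp add: mem_box_cart)
  then have Qne: "Q \<noteq> {}"
    using Q(3) by auto
  \<comment> \<open>Restriction to an enumeration of \<open>Q\<close> maps the ball into
    \<open>nat \<Rightarrow> real\<close>, where convergence of coordinates means convergence at the
    points of \<open>Q\<close>. Chosen preimages of a dense set \<open>T\<close> of images form
    \<open>D\<close>.\<close>
  define e :: "(real ^ 'd \<Rightarrow> real) \<Rightarrow> nat \<Rightarrow> real" where "e f n = f (from_nat_into Q n)" for f n
  obtain T where T: "countable T" "T \<subseteq> e ` tree_unit L" "e ` tree_unit L \<subseteq> closure T"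
    by (rule separable)
  define D where "D = inv_into (tree_unit L) e ` T"
  have D: "D \<subseteq> tree_unit L"
    using T(2) by (auto simp: D_def intro!: inv_into_into)
  have e_inv: "e (inv_into (tree_unit L) e t) = t" if "t \<in> T" for t
  proof -
    have "t \<in> e ` tree_unit L"
      using that T(2) by blast
    then show ?thesis
      by (rule f_inv_into_f)
  qed
  show thesis
  proof
    show "countable D"
      using T(1) by (simp add: D_def)
    show "D \<subseteq> tree_unit L" by fact
    fix f :: "real ^ 'd \<Rightarrow> real" assume f: "f \<in> tree_unit L"
    then have "e f \<in> closure T"
      using T(3) by auto
    then obtain t where t: "\<And>k. t k \<in> T" "t \<longlonglongrightarrow> e f"
      unfolding closure_sequential by blast
    define h where "h k = inv_into (tree_unit L) e (t k)" for k
    have h: "h k \<in> D" "e (h k) = t k" for k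
      using t(1) e_inv by (auto simp: h_def D_def)
    have hU: "h k \<in> tree_unit L" for k
      using h(1) D by auto
    have conv: "(\<lambda>k. h k q) \<longlonglongrightarrow> f q" if qQ: "q \<in> Q" for q
    proof -
      obtain n where n: "from_nat_into Q n = q"
        using from_nat_into_surj[OF Q(1) qQ] by auto
      have "(\<lambda>k. t k n) \<longlonglongrightarrow> e f n"
        by (rule continuous_on_tendsto_compose[OF continuous_on_product_coordinates t(2)]) auto
      then show ?thesis
        by (simp add: h(2) [symmetric] e_def n)
    qed
    have "(\<lambda>k. h k x) \<longlonglongrightarrow> f x" for x
    proof (cases "x \<in> unit_cube")
      case True
      show ?thesis
      proof (rule LIMSEQ_I)
        fix r :: real assume r: "0 < r"
        then have "0 < r / 3"
          by simp
        moreover have "x \<in> closure Q"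
          using True Q(3) by auto
        ultimately obtain q where q: "q \<in> Q" "dist q x < r / 3"
          unfolding closure_approachable by blast
        obtain N where N: "\<And>k. k \<ge> N \<Longrightarrow> norm (h k q - f q) < r / 3"
          using LIMSEQ_D[OF conv[OF q(1)], of "r / 3"] r by auto
        have qc: "q \<in> unit_cube"
          using q Q by auto
        have "norm (h k x - f x) < r" if "k \<ge> N" for k
        proof -
          have "\<bar>h k q - h k x\<bar> \<le> dist q x" "\<bar>f q - f x\<bar> \<le> dist q x"
            using hU[of k] f qc True by (auto intro: tree_unit_bounds(2))
          moreover have "\<bar>h k q - f q\<bar> < r / 3"
            using N[OF that] by simp
          ultimately show ?thesis
            using q(2) unfolding real_norm_def by linarith
        qed
        then show "\<exists>N. \<forall>k\<ge>N. norm (h k x - f x) < r"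
          by auto
      qed
    next
      case False
      have ext: "g x = undefined" if "g \<in> tree_unit L" for g
        using tree_norm_extensional[of L g] le_less_trans[of "tree_norm L g" 1 \<top>] that False
        by (intro extensional_arb[of g unit_cube x]) auto
      show ?thesis
        using ext[OF f] ext[OF hU] by simp
    qed
    then show "\<exists>h. (\<forall>k. h k \<in> D) \<and> (\<forall>x. (\<lambda>k. h k x) \<longlonglongrightarrow> f x)"
      using h(1) by auto
  qed
qed

section \<open>Symmetrisation\<close>

lemma ennreal_integral_le_nn_integral:
  assumes "integrable M h"
  shows "ennreal (integral\<^sup>L M h) \<le> (\<integral>\<^sup>+ x. ennreal (h x) \<partial>M)"
proof -
  have "ennreal (integral\<^sup>L M h) \<le> ennreal (\<integral>x. max 0 (h x) \<partial>M)"
    using assms by (intro ennreal_leI integral_mono) auto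
  also have "\<dots> = (\<integral>\<^sup>+ x. ennreal (max 0 (h x)) \<partial>M)"
    using assms by (intro nn_integral_eq_integral [symmetric]) auto
  also have "\<dots> = (\<integral>\<^sup>+ x. ennreal (h x) \<partial>M)"
    by (intro nn_integral_cong) (auto simp: max_def ennreal_neg)
  finally show ?thesis .
qed

lemma ennreal_add_le: "ennreal (a + b) \<le> ennreal a + ennreal b"
proof -
  have "ennreal (a + b) \<le> ennreal (max 0 a + max 0 b)"
    by (intro ennreal_leI) auto
  then show ?thesis
    by (simp add: ennreal_max_0)
qed

text \<open>The sample \<open>z i\<close> and the ghost sample \<open>z (n + i)\<close> are bounded
  separately, which gives the factor 2. Passing to the complement of \<open>E\<close> absorbs the
  minus sign of the second half, and the sum over all \<open>E\<close> is invariant under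
  it.\<close>

lemma tree_rademacher_difference_le:
  fixes z :: "nat \<Rightarrow> real ^ 'd"
  assumes z: "\<And>j. j < 2 * n \<Longrightarrow> z j \<in> unit_cube" and n: "n \<ge> 1"
  shows "(\<Sum>E\<in>Pow {..<n}. SUP f\<in>tree_unit L. ennreal ((\<Sum>i<n. rademacher E i * (f (z i) - f (z (n + i)))) / n))
       \<le> ennreal (2 ^ n * (2 * sqrt (2 * tree_log TYPE('d) L) * n powr (- (1/2))))"
proof -
  let ?R = "\<lambda>x E. SUP f\<in>tree_unit L. ennreal (\<Sum>i<n. rademacher E i * f (x i))"
  define k where "k = tree_log TYPE('d) L"
  let ?b = "2 ^ n * sqrt (2 * n * k)"
  have b: "0 \<le> ?b"
    using tree_log_ge_1[where 'd = 'd, of L] by (simp add: k_def)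
  have "sqrt n / n = n powr (- (1/2))"
    by (simp only: powr_minus powr_half_sqrt of_nat_0_le_iff sqrt_divide_self_eq)
  moreover have "1 / n * (?b + ?b) = 2 ^ n * (2 * sqrt (2 * k) * (sqrt n / n))"
    by (simp add: real_sqrt_mult)
  ultimately have scale: "2 ^ n * (2 * sqrt (2 * k) * n powr (- (1/2))) = 1 / n * (?b + ?b)"
    by (simp only:)
  have R: "(\<Sum>E\<in>Pow {..<n}. ?R x E) \<le> ennreal ?b" if "\<And>i. i < n \<Longrightarrow> x i \<in> unit_cube" for x :: "nat \<Rightarrow> real ^ 'd"
    using tree_rademacher_le[of "{..<n}" x L] that n by (auto simp: lessThan_empty_iff k_def)
  have compl: "(\<Sum>i<n. rademacher ({..<n} - E) i * y i) = - (\<Sum>i<n. rademacher E i * y i)" for E y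
    by (auto simp: rademacher_def simp flip: sum_negf intro!: sum.cong)
  have le: "(SUP f\<in>tree_unit L. ennreal ((\<Sum>i<n. rademacher E i * (f (z i) - f (z (n + i)))) / n))
      \<le> ennreal (1 / n) * (?R z E + ?R (\<lambda>i. z (n + i)) ({..<n} - E))" for E
  proof (rule SUP_least)
    fix f :: "real ^ 'd \<Rightarrow> real" assume f: "f \<in> tree_unit L"
    let ?a = "\<Sum>i<n. rademacher E i * f (z i)" and ?c = "\<Sum>i<n. rademacher ({..<n} - E) i * f (z (n + i))"
    have "ennreal (?a + ?c) \<le> ?R z E + ?R (\<lambda>i. z (n + i)) ({..<n} - E)"
      using f by (intro order_trans[OF ennreal_add_le] add_mono SUP_upper)
    then have "ennreal (1 / n) * ennreal (?a + ?c) \<le> ennreal (1 / n) * (?R z E + ?R (\<lambda>i. z (n + i)) ({..<n} - E))"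
      by (rule mult_left_mono) simp
    moreover have "(\<Sum>i<n. rademacher E i * (f (z i) - f (z (n + i)))) = ?a + ?c"
      unfolding compl by (simp add: right_diff_distrib sum_subtractf)
    moreover have "ennreal ((?a + ?c) / n) = ennreal (1 / n) * ennreal (?a + ?c)"
      by (subst ennreal_mult' [symmetric]) auto
    ultimately show "ennreal ((\<Sum>i<n. rademacher E i * (f (z i) - f (z (n + i)))) / n)
      \<le> ennreal (1 / n) * (?R z E + ?R (\<lambda>i. z (n + i)) ({..<n} - E))"
      by simp
  qed
  have "(\<Sum>E\<in>Pow {..<n}. SUP f\<in>tree_unit L. ennreal ((\<Sum>i<n. rademacher E i * (f (z i) - f (z (n + i)))) / n))
      \<le> (\<Sum>E\<in>Pow {..<n}. ennreal (1 / n) * (?R z E + ?R (\<lambda>i. z (n + i)) ({..<n} - E)))"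
    by (intro sum_mono le)
  also have "\<dots> = ennreal (1 / n) * ((\<Sum>E\<in>Pow {..<n}. ?R z E) + (\<Sum>E\<in>Pow {..<n}. ?R (\<lambda>i. z (n + i)) E))"
    unfolding sum_distrib_left [symmetric] sum.distrib by (subst sum_Pow_compl) auto
  also have "\<dots> \<le> ennreal (1 / n) * (ennreal ?b + ennreal ?b)"
    using z by (intro mult_left_mono add_mono R) auto
  also have "\<dots> = ennreal (1 / n * (?b + ?b))"
    using b by (subst ennreal_mult') (auto simp only: ennreal_plus [OF b b] divide_nonneg_nonneg zero_le_one of_nat_0_le_iff)
  finally show ?thesis
    unfolding k_def [symmetric] scale .
qed

text \<open>Symmetrisation with a ghost sample: the mean of \<open>f\<close> is its average over
  \<open>n\<close> further independent points, and exchanging \<open>z i\<close> with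
  \<open>z (n + i)\<close> preserves the product measure. The integral therefore equals its average
  over all signs, to which the Rademacher bound applies pointwise.\<close>

theorem monte_carlo_tree: "monte_carlo TYPE('d::finite) L (2 * sqrt (2 * tree_log TYPE('d) L))"
  unfolding monte_carlo_def
proof (intro allI impI)
  fix n :: nat assume n: "n \<ge> 1"
  let ?U = "cube_uniform :: (real ^ 'd) measure"
  let ?M = "\<lambda>I :: nat set. \<Pi>\<^sub>M i\<in>I. ?U"
  let ?I = "{..<n}" and ?J = "{n..<2 * n}"
  have IJ: "?I \<union> ?J = {..<2 * n}" "?I \<inter> ?J = {}"
    by auto
  interpret U: prob_space ?U
    by (rule prob_space_cube_uniform)
  interpret P: product_prob_space "\<lambda>_ :: nat. ?U" I for I
    by unfold_locales
  obtain D :: "(real ^ 'd \<Rightarrow> real) set" where D: "countable D" "D \<subseteq> tree_unit L"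
    "\<And>f. f \<in> tree_unit L \<Longrightarrow> \<exists>h. (\<forall>k::nat. h k \<in> D) \<and> (\<forall>x. (\<lambda>k. h k x) \<longlonglongrightarrow> f x)"
    using tree_unit_separable[of L] by blast
  have tree_meas [measurable]: "f \<in> borel_measurable ?U" if "f \<in> tree_unit L" for f
    using tree_unit_measurable[OF that] by (simp only: borel_measurable_cube_uniform)
  \<comment> \<open>The supremum over the countable \<open>D\<close> is measurable, as the change of
    variables and the iterated integral require. The choice \<open>E = UNIV\<close> makes all signs
    positive.\<close>
  define G where "G E z = (SUP f\<in>D. ennreal ((\<Sum>i<n. rademacher E i * (f (z i) - f (z (n + i)))) / n))"
    for E and z :: "nat \<Rightarrow> real ^ 'd"
  have G_meas [measurable]: "G E \<in> borel_measurable (?M {..<2 * n})" for E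
    unfolding G_def
  proof (intro borel_measurable_SUP D(1))
    fix f assume "f \<in> D"
    then have f: "f \<in> borel_measurable ?U"
      using D(2) tree_meas by auto
    have comp: "(\<lambda>z. f (z j)) \<in> borel_measurable (?M {..<2 * n})" if "j \<in> {..<2 * n}" for j
      using that by (intro measurable_compose[where f = "\<lambda>z. z j", OF _ f] measurable_component_singleton)
    show "(\<lambda>z. ennreal ((\<Sum>i<n. rademacher E i * (f (z i) - f (z (n + i)))) / n)) \<in> borel_measurable (?M {..<2 * n})"
      using n by (intro measurable_compose[OF _ measurable_ennreal] borel_measurable_divide borel_measurable_sum
          borel_measurable_times borel_measurable_diff comp) auto
  qed

  \<comment> \<open>Integrating out the ghost sample bounds the empirical error of a single
    \<open>f\<close>. This is done for \<open>f\<close> in \<open>D\<close> and then extended to the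
    ball by dominated convergence.\<close>
  have empirical_le: "ennreal ((\<Sum>i<n. f (x i)) / n - (LINT y:unit_cube|lebesgue. f y))
      \<le> (\<integral>\<^sup>+ y. G UNIV (merge ?I ?J (x, y)) \<partial>?M ?J)" (is "ennreal (?A f) \<le> ?G") if fL: "f \<in> tree_unit L" for f x
  proof -
    have le: "ennreal (?A f) \<le> ?G" if "f \<in> D" for f
    proof -
      have f: "f \<in> tree_unit L"
        using that D(2) by auto
      have comp: "integrable (?M ?J) (\<lambda>y. f (y j))" "(\<integral>y. f (y j) \<partial>?M ?J) = integral\<^sup>L ?U f" if "j \<in> ?J" for j
      proof -
        have d: "distr (?M ?J) ?U (\<lambda>y. y j) = ?U"
          using that by (intro distr_PiM_component prob_space_cube_uniform)
        have m: "(\<lambda>y. y j) \<in> measurable (?M ?J) ?U"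
          using that by (rule measurable_component_singleton)
        show "integrable (?M ?J) (\<lambda>y. f (y j))"
          using integrable_distr_eq[OF m, of f] tree_meas[OF f] tree_unit_integrable[OF f] d by simp
        show "(\<integral>y. f (y j) \<partial>?M ?J) = integral\<^sup>L ?U f"
          using integral_distr[OF m, of f] tree_meas[OF f] d by simp
      qed
      let ?h = "\<lambda>y. (\<Sum>i<n. f (x i) - f (y (n + i))) / n"
      have int: "integrable (?M ?J) ?h"
        by (intro integrable_divide Bochner_Integration.integrable_sum Bochner_Integration.integrable_diff comp) auto
      have "integral\<^sup>L (?M ?J) ?h = (\<Sum>i<n. f (x i) - integral\<^sup>L ?U f) / n"
        using comp prob_space.prob_space[OF prob_space_PiM[of ?J "\<lambda>_. ?U", OF prob_space_cube_uniform]] by simp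
      also have "\<dots> = (\<Sum>i<n. f (x i)) / n - integral\<^sup>L ?U f"
        using n by (simp add: sum_subtractf diff_divide_distrib)
      also have "\<dots> = ?A f"
        by (simp add: integral_cube_uniform tree_unit_measurable[OF f])
      finally have "ennreal (?A f) \<le> (\<integral>\<^sup>+ y. ennreal (?h y) \<partial>?M ?J)"
        using ennreal_integral_le_nn_integral[OF int] by simp
      also have "\<dots> \<le> ?G"
      proof (rule nn_integral_mono)
        fix y assume "y \<in> space (?M ?J)"
        have "?h y = (\<Sum>i<n. rademacher UNIV i * (f (merge ?I ?J (x, y) i) - f (merge ?I ?J (x, y) (n + i)))) / n"
          by (intro arg_cong2[where f = divide] sum.cong) (auto simp: rademacher_def merge_def)
        then show "ennreal (?h y) \<le> G UNIV (merge ?I ?J (x, y))"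
          unfolding G_def using that by (intro SUP_upper2[of f]) auto
      qed
      finally show ?thesis .
    qed
    obtain h where h: "\<And>k::nat. h k \<in> D" "\<And>x. (\<lambda>k. h k x) \<longlonglongrightarrow> f x"
      using D(3)[OF fL] by auto
    have hU: "h k \<in> tree_unit L" for k
      using h(1) D(2) by auto
    have "(\<lambda>k. integral\<^sup>L ?U (h k)) \<longlonglongrightarrow> integral\<^sup>L ?U f"
    proof (rule integral_dominated_convergence[where w = "\<lambda>_. 1"])
      show "AE x in ?U. norm (h k x) \<le> 1" for k
        using hU[of k] tree_unit_bounds(1)[of L "h k"] by (intro eventually_mono[OF AE_cube_uniform]) auto
    qed (use tree_meas fL hU h(2) in auto)
    then have "(\<lambda>k. ?A (h k)) \<longlonglongrightarrow> ?A f"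
      using fL hU
      by (intro tendsto_diff tendsto_divide tendsto_sum h(2)) (use n in \<open>auto simp: integral_cube_uniform tree_unit_measurable\<close>)
    then show ?thesis
      by (intro LIMSEQ_le_const2[OF tendsto_ennrealI]) (auto intro: le h(1))
  qed

  have swap: "(\<integral>\<^sup>+ z. G UNIV z \<partial>?M {..<2 * n}) = (\<integral>\<^sup>+ z. G E z \<partial>?M {..<2 * n})" for E
  proof -
    \<comment> \<open>Exchanges \<open>j\<close> and \<open>n + j\<close> exactly for those
      \<open>j < n\<close> outside \<open>E\<close>, that is, where the sign is -1.\<close>
    define t where "t j = (if j < n then if j \<in> E then j else n + j else if j - n \<in> E then j else j - n)" for j
    have t: "inj_on t {..<2 * n}" "t \<in> {..<2 * n} \<rightarrow> {..<2 * n}"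
      by (auto simp: t_def inj_on_def split: if_splits)
    have d: "distr (?M {..<2 * n}) (?M {..<2 * n}) (\<lambda>z. \<lambda>j\<in>{..<2 * n}. z (t j)) = ?M {..<2 * n}"
      by (rule distr_PiM_reindex[OF prob_space_cube_uniform t])
    have m: "(\<lambda>z. \<lambda>j\<in>{..<2 * n}. z (t j)) \<in> measurable (?M {..<2 * n}) (?M {..<2 * n})"
      using t(2) by (intro measurable_restrict measurable_component_singleton) auto
    have "(\<integral>\<^sup>+ z. G UNIV z \<partial>?M {..<2 * n}) =
        (\<integral>\<^sup>+ z. G UNIV z \<partial>distr (?M {..<2 * n}) (?M {..<2 * n}) (\<lambda>z. \<lambda>j\<in>{..<2 * n}. z (t j)))"
      by (simp only: d)
    also have "\<dots> = (\<integral>\<^sup>+ z. G UNIV (\<lambda>j\<in>{..<2 * n}. z (t j)) \<partial>?M {..<2 * n})"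
      by (rule nn_integral_distr[OF m]) (use G_meas[of UNIV] in simp)
    also have "\<dots> = (\<integral>\<^sup>+ z. G E z \<partial>?M {..<2 * n})"
      unfolding G_def
      by (intro nn_integral_cong SUP_cong refl arg_cong[where f = ennreal] arg_cong2[where f = divide] sum.cong)
         (auto simp: t_def rademacher_def)
    finally show ?thesis .
  qed

  have bound: "AE z in ?M {..<2 * n}. (\<Sum>E\<in>Pow {..<n}. G E z)
      \<le> ennreal (2 ^ n * (2 * sqrt (2 * tree_log TYPE('d) L) * n powr (- (1/2))))" (is "AE z in _. _ \<le> ?b")
  proof -
    \<comment> \<open>The Rademacher bound needs all points in the cube, which holds outside a null
      set.\<close>
    have "AE z in ?M {..<2 * n}. \<forall>j\<in>{..<2 * n}. z j \<in> unit_cube"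
      by (intro AE_finite_allI AE_PiM_component[where P = "\<lambda>x. x \<in> unit_cube"] prob_space_cube_uniform AE_cube_uniform) auto
    then show ?thesis
    proof (rule AE_mp, intro AE_I2 impI)
      fix z assume z: "\<forall>j\<in>{..<2 * n}. z j \<in> (unit_cube :: (real ^ 'd) set)"
      have "(\<Sum>E\<in>Pow {..<n}. G E z) \<le> (\<Sum>E\<in>Pow {..<n}. SUP f\<in>tree_unit L.
          ennreal ((\<Sum>i<n. rademacher E i * (f (z i) - f (z (n + i)))) / n))"
        unfolding G_def by (intro sum_mono SUP_subset_mono D(2) order_refl)
      also have "\<dots> \<le> ?b"
        using z n by (intro tree_rademacher_difference_le) auto
      finally show "(\<Sum>E\<in>Pow {..<n}. G E z) \<le> ?b" .
    qed
  qed

  have "2 ^ n * (\<integral>\<^sup>+ z. G UNIV z \<partial>?M {..<2 * n}) = (\<Sum>E\<in>Pow {..<n}. \<integral>\<^sup>+ z. G UNIV z \<partial>?M {..<2 * n})"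
    by (simp add: card_Pow)
  also have "\<dots> = (\<Sum>E\<in>Pow {..<n}. \<integral>\<^sup>+ z. G E z \<partial>?M {..<2 * n})"
    by (intro sum.cong refl swap)
  also have "\<dots> = (\<integral>\<^sup>+ z. (\<Sum>E\<in>Pow {..<n}. G E z) \<partial>?M {..<2 * n})"
    by (intro nn_integral_sum [symmetric] G_meas)
  also have "\<dots> \<le> (\<integral>\<^sup>+ z. ennreal (2 ^ n * (2 * sqrt (2 * tree_log TYPE('d) L) * n powr (- (1/2)))) \<partial>?M {..<2 * n})"
    by (rule nn_integral_mono_AE[OF bound])
  also have "\<dots> = 2 ^ n * ennreal (2 * sqrt (2 * tree_log TYPE('d) L) * n powr (- (1/2)))"
    by (simp add: P.emeasure_space_1 ennreal_mult' flip: ennreal_power)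
  finally have G_le: "(\<integral>\<^sup>+ z. G UNIV z \<partial>?M {..<2 * n}) \<le> ennreal (2 * sqrt (2 * tree_log TYPE('d) L) * n powr (- (1/2)))"
    by (subst (asm) ennreal_mult_le_mult_iff) (auto simp: power_eq_top_ennreal)

  \<comment> \<open>Here the supremum is over the whole ball; it is compared pointwise with the
    inner integral of \<open>G UNIV\<close>, and monotonicity of the integral asks for no
    measurability.\<close>
  have "(\<integral>\<^sup>+ x. (SUP f\<in>tree_ball L 1. ennreal ((\<Sum>i<n. f (x i)) / n - (LINT y:unit_cube|lebesgue. f y))) \<partial>?M ?I)
      \<le> (\<integral>\<^sup>+ x. (\<integral>\<^sup>+ y. G UNIV (merge ?I ?J (x, y)) \<partial>?M ?J) \<partial>?M ?I)"
    by (intro nn_integral_mono SUP_least empirical_le) (simp add: tree_ball_def)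
  also have "\<dots> = (\<integral>\<^sup>+ z. G UNIV z \<partial>?M (?I \<union> ?J))"
    using IJ by (intro P.product_nn_integral_fold [symmetric]) (auto simp: IJ)
  also have "\<dots> \<le> ennreal (2 * sqrt (2 * tree_log TYPE('d) L) * n powr (- (1/2)))"
    using G_le by (simp only: IJ)
  finally show "(\<integral>\<^sup>+ x. (SUP f\<in>tree_ball L 1. ennreal ((\<Sum>i<n. f (x i)) / n - (LINT y:unit_cube|lebesgue. f y))) \<partial>?M ?I)
      \<le> ennreal (2 * sqrt (2 * tree_log TYPE('d) L) * n powr (- (1/2)))" .
qed

section \<open>The discrepancy functional\<close>

lemma set_integrable_unit_cube:
  fixes \<phi> :: "real ^ 'd \<Rightarrow> real"
  assumes "continuous_on unit_cube \<phi>" "S \<in> sets lebesgue" "S \<subseteq> unit_cube"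
  shows "set_integrable lebesgue S \<phi>"
proof (rule set_integrable_subset)
  have "integrable lborel (\<lambda>x. indicator unit_cube x *\<^sub>R \<phi> x)"
    by (rule borel_integrable_compact[OF compact_cbox assms(1)])
  then show "set_integrable lebesgue unit_cube \<phi>"
    unfolding set_integrable_def by (subst integrable_completion) auto
qed (use assms in auto)

lemma periodic_ball_subset: "periodic_ball x r \<subseteq> unit_cube"
  by (auto simp: periodic_ball_def)

lemma sets_periodic_ball: "periodic_ball x r \<in> sets lebesgue"
proof -
  have "periodic_ball x r = unit_cube \<inter> (\<Union>k\<in>{k. \<forall>i. k $ i \<in> \<int>}. ball (x + k) r)"
    by (auto simp: periodic_ball_def)
  moreover have "open (\<Union>k\<in>{k. \<forall>i. k $ i \<in> \<int>}. ball (x + k) r)"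
    by (intro open_UN) auto
  then have "unit_cube \<inter> (\<Union>k\<in>{k. \<forall>i. k $ i \<in> \<int>}. ball (x + k) r) \<in> sets borel"
    by (intro sets.Int borel_open borel_closed) auto
  ultimately show ?thesis
    by (simp add: sets_completionI_sets)
qed

lemma ball_discrepancy_diff:
  assumes "continuous_on unit_cube \<phi>" "continuous_on unit_cube f"
  shows "ball_discrepancy r n x (\<lambda>y. \<phi> y - f y) = ball_discrepancy r n x \<phi> - ball_discrepancy r n x f"
proof -
  have "(LINT y:S|lebesgue. \<phi> y - f y) = (LINT y:S|lebesgue. \<phi> y) - (LINT y:S|lebesgue. f y)"
    if "S \<in> sets lebesgue" "S \<subseteq> unit_cube" for S
    using assms that by (intro set_integral_diff set_integrable_unit_cube)
  then show ?thesis
    unfolding ball_discrepancy_def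
    by (simp add: sets_periodic_ball periodic_ball_subset diff_divide_distrib sum_subtractf)
qed

lemma ball_discrepancy_cmult:
  "ball_discrepancy r n x (\<lambda>y. a * \<phi> y) = a * ball_discrepancy r n x \<phi>"
  unfolding ball_discrepancy_def by (simp add: right_diff_distrib sum_distrib_left)

lemma ball_discrepancy_restrict:
  "ball_discrepancy r n x (restrict \<phi> unit_cube) = ball_discrepancy r n x \<phi>"
proof -
  have eq: "(LINT y:S|lebesgue. restrict \<phi> unit_cube y) = (LINT y:S|lebesgue. \<phi> y)"
    if "S \<in> sets lebesgue" "S \<subseteq> unit_cube" for S
    using that by (intro set_lebesgue_integral_cong) auto
  have cube: "(LINT y:unit_cube|lebesgue. restrict \<phi> unit_cube y) = (LINT y:unit_cube|lebesgue. \<phi> y)"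
    by (rule eq) auto
  show ?thesis
    unfolding ball_discrepancy_def by (simp only: eq[OF sets_periodic_ball periodic_ball_subset] cube)
qed

lemma abs_set_integral_unit_cube_le:
  fixes \<phi> :: "real ^ 'd \<Rightarrow> real"
  assumes "\<And>y. y \<in> unit_cube \<Longrightarrow> \<bar>\<phi> y\<bar> \<le> 1" "continuous_on unit_cube \<phi>" "S \<in> sets lebesgue" "S \<subseteq> unit_cube"
  shows "\<bar>LINT y:S|lebesgue. \<phi> y\<bar> \<le> measure lebesgue S"
proof -
  have S: "set_integrable lebesgue S (\<lambda>_. 1 :: real)"
    using assms by (intro set_integrable_unit_cube) auto
  have "\<bar>LINT y:S|lebesgue. \<phi> y\<bar> \<le> (LINT y:S|lebesgue. \<bar>\<phi> y\<bar>)"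
    using set_integral_norm_bound[OF set_integrable_unit_cube[OF assms(2-4)]] by simp
  also have "\<dots> \<le> (LINT y:S|lebesgue. 1)"
    using assms by (intro set_integral_mono S set_integrable_unit_cube continuous_on_rabs) auto
  also have "\<dots> = measure lebesgue S"
    using assms(3) by (simp add: set_lebesgue_integral_def)
  finally show ?thesis .
qed

lemma measure_unit_cube: "measure lebesgue (unit_cube :: (real ^ 'd) set) = 1"
  by (simp add: measure_def emeasure_unit_cube)

lemma L2_norm_nonneg: "0 \<le> L2_norm \<phi>"
  by (simp add: L2_norm_def set_lebesgue_integral_def)

lemma L2_norm_cmult: "0 \<le> a \<Longrightarrow> L2_norm (\<lambda>x. a * \<phi> x) = a * L2_norm \<phi>"
  unfolding L2_norm_def by (simp add: power_mult_distrib real_sqrt_mult)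

text \<open>Homogeneity extends the bound from the unit ball. Dividing by an arbitrary
  \<open>s\<close> above the norm also covers functions of norm 0.\<close>

lemma ball_discrepancy_le_L2_norm:
  fixes x :: "nat \<Rightarrow> real ^ 'd"
  assumes C: "(SUP \<psi>\<in>L2_ball. ereal (ball_discrepancy r n x \<psi>)) \<le> ereal C" "0 \<le> C"
    and \<phi>: "continuous_on unit_cube \<phi>"
  shows "ball_discrepancy r n x \<phi> \<le> C * L2_norm \<phi>"
proof (rule le_mult_if_le_mult_greater[OF _ C(2)])
  fix s assume s: "L2_norm \<phi> < s"
  then have s0: "0 < s"
    using L2_norm_nonneg[of \<phi>] by linarith
  let ?\<psi> = "\<lambda>y. inverse s * \<phi> y"
  have cont: "continuous_on unit_cube ?\<psi>" "continuous_on unit_cube (\<lambda>y. (?\<psi> y)\<^sup>2)"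
    using \<phi> by (auto intro!: continuous_intros)
  have "L2_norm ?\<psi> \<le> 1"
    using s s0 by (subst L2_norm_cmult) (auto simp: field_simps)
  moreover have "?\<psi> \<in> borel_measurable (lebesgue_on unit_cube)"
    using cont(1) by (intro continuous_imp_measurable_on_sets_lebesgue) auto
  moreover have "integrable (lebesgue_on unit_cube) (\<lambda>y. (?\<psi> y)\<^sup>2)"
    using set_integrable_unit_cube[OF cont(2), of unit_cube]
    by (subst integrable_restrict_space) (auto simp: set_integrable_def)
  ultimately have "?\<psi> \<in> L2_ball"
    by (simp add: L2_ball_def)
  then have "ereal (ball_discrepancy r n x ?\<psi>) \<le> ereal C"
    by (intro order_trans[OF SUP_upper C(1)])
  then have "inverse s * ball_discrepancy r n x \<phi> \<le> C"
    by (simp add: ball_discrepancy_cmult)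
  then show "ball_discrepancy r n x \<phi> \<le> C * s"
    using s0 by (simp add: field_simps)
qed

lemma lipschitz_ball_bounds:
  assumes "\<phi> \<in> lipschitz_ball"
  shows "\<And>x. x \<in> unit_cube \<Longrightarrow> \<bar>\<phi> x\<bar> \<le> 1" "continuous_on unit_cube \<phi>"
proof -
  let ?a = "SUP x\<in>unit_cube. ennreal \<bar>\<phi> x\<bar>"
  let ?b = "SUP (x, y)\<in>{(x, y). x \<in> unit_cube \<and> y \<in> unit_cube \<and> x \<noteq> y}. ennreal (\<bar>\<phi> x - \<phi> y\<bar> / infnorm (x - y))"
  have "?a + ?b \<le> 1"
    using assms by (simp add: lipschitz_ball_def lipschitz_norm_def)
  then have ab: "?a \<le> 1" "?b \<le> 1"
    by (auto intro: order_trans[rotated])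
  show "\<bar>\<phi> x\<bar> \<le> 1" if "x \<in> unit_cube" for x
  proof -
    have "ennreal \<bar>\<phi> x\<bar> \<le> ?a"
      using that by (rule SUP_upper)
    from order_trans[OF this ab(1)] show ?thesis
      by simp
  qed
  have "\<bar>\<phi> x - \<phi> y\<bar> \<le> dist x y" if "x \<in> unit_cube" "y \<in> unit_cube" for x y
  proof (cases "x = y")
    case False
    have "ennreal (\<bar>\<phi> x - \<phi> y\<bar> / infnorm (x - y)) \<le> ?b"
      using that False by (intro SUP_upper2[of "(x, y)"]) auto
    from order_trans[OF this ab(2)] have "\<bar>\<phi> x - \<phi> y\<bar> / infnorm (x - y) \<le> 1"
      by simp
    moreover have "0 < infnorm (x - y)"
      using False by (simp add: infnorm_pos_lt)
    ultimately show ?thesis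
      using infnorm_le_norm[of "x - y"] by (simp add: dist_norm divide_le_eq)
  qed auto
  then have "1-lipschitz_on unit_cube \<phi>"
    by (intro lipschitz_onI) (auto simp: dist_real_def)
  then show "continuous_on unit_cube \<phi>"
    by (rule lipschitz_on_continuous_on)
qed

lemma tree_ball_continuous:
  assumes "f \<in> tree_ball L t" "0 \<le> t"
  shows "continuous_on unit_cube f"
proof -
  have "t-lipschitz_on unit_cube f"
    using assms tree_norm_bounds(2)[of L f t] by (intro lipschitz_onI) (auto simp: tree_ball_def dist_real_def)
  then show ?thesis
    by (rule lipschitz_on_continuous_on)
qed

text \<open>Rescaling to the unit ball needs the restricted function, since members of the tree-like
  spaces are extensional; the discrepancy sees only values on the cube.\<close>

lemma ball_discrepancy_tree_ball_le:
  assumes K: "(SUP g\<in>tree_ball L 1. ereal (ball_discrepancy r n x g)) \<le> ereal b"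
    and f: "f \<in> tree_ball L t" and t: "0 < t"
  shows "ball_discrepancy r n x f \<le> t * b"
proof -
  let ?g = "restrict (\<lambda>y. inverse t * f y) unit_cube"
  have "?g \<in> tree_ball L 1"
    using tree_norm_scale[of L f t "inverse t"] f t by (simp add: tree_ball_def)
  then have "ereal (ball_discrepancy r n x ?g) \<le> ereal b"
    by (intro order_trans[OF SUP_upper K])
  then have "inverse t * ball_discrepancy r n x f \<le> b"
    by (simp add: ball_discrepancy_restrict ball_discrepancy_cmult)
  then show ?thesis
    using t by (simp add: field_simps)
qed

section \<open>The lower bound\<close>

lemma discrepancy_constantsE:
  assumes "discrepancy_constants TYPE('d::finite) c C" "monte_carlo TYPE('d) L CX" "n \<ge> 1"
  obtains r and x :: "nat \<Rightarrow> real ^ 'd" where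
    "(SUP \<phi>\<in>lipschitz_ball. ereal (ball_discrepancy r n x \<phi>)) \<ge> ereal (c * real n powr (- (1 / real CARD('d))))"
    "(SUP \<phi>\<in>L2_ball. ereal (ball_discrepancy r n x \<phi>)) \<le> ereal C"
    "(SUP f\<in>tree_ball L 1. ereal (ball_discrepancy r n x f)) \<le> ereal (3 * CX * real n powr (- (1 / 2)))"
proof -
  obtain \<gamma> where \<gamma>: "\<forall>L CX. monte_carlo TYPE('d) L CX \<longrightarrow> (\<forall>n::nat. n \<ge> 1 \<longrightarrow> (\<exists>x :: nat \<Rightarrow> real ^ 'd.
      let A = ball_discrepancy (\<gamma> * real n powr (- (1 / real CARD('d)))) n x in
      (\<forall>i<n. x i \<in> unit_cube) \<and>
      (SUP \<phi>\<in>lipschitz_ball. ereal (A \<phi>)) \<ge> ereal (c * real n powr (- (1 / real CARD('d)))) \<and>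
      (SUP \<phi>\<in>L2_ball. ereal (A \<phi>)) \<le> ereal C \<and>
      (SUP f\<in>tree_ball L 1. ereal (A f)) \<le> ereal (3 * CX * real n powr (- (1 / 2)))))"
    using assms(1) unfolding discrepancy_constants_def by (elim conjE exE) (rule that)
  show ?thesis
    using \<gamma>[rule_format, OF assms(2,3)] unfolding Let_def by (elim exE conjE) (rule that)
qed

text \<open>For a single point the functional is a difference of two averages of a function bounded
  by 1. The bound guarantees \<open>c / 2 \<le> K * t\<close> whenever \<open>K\<close> and
  \<open>t\<close> are at least 1.\<close>

lemma discrepancy_constants_le_2:
  assumes "discrepancy_constants TYPE('d::finite) c C"
  shows "c \<le> 2"
proof -
  obtain r and x :: "nat \<Rightarrow> real ^ 'd" where
    "ereal (c * real 1 powr (- (1 / real CARD('d)))) \<le> (SUP \<phi>\<in>lipschitz_ball. ereal (ball_discrepancy r 1 x \<phi>))"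
    using discrepancy_constantsE[OF assms monte_carlo_tree[of 0] order_refl] .
  moreover have "(SUP \<phi>\<in>lipschitz_ball. ereal (ball_discrepancy r 1 x \<phi>)) \<le> ereal 2"
  proof (rule SUP_least)
    fix \<phi> :: "real ^ 'd \<Rightarrow> real" assume "\<phi> \<in> lipschitz_ball"
    note \<phi> = lipschitz_ball_bounds[OF this]
    let ?B = "periodic_ball (x 0) r"
    have "\<bar>LINT y:?B|lebesgue. \<phi> y\<bar> \<le> measure lebesgue ?B"
      by (rule abs_set_integral_unit_cube_le[OF \<phi> sets_periodic_ball periodic_ball_subset])
    \<comment> \<open>For a null ball the quotient is 0 by convention, so no condition on
      \<open>r\<close> enters.\<close>
    then have "\<bar>(LINT y:?B|lebesgue. \<phi> y) / measure lebesgue ?B\<bar> \<le> 1"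
      by (simp add: divide_le_eq)
    moreover have "\<bar>LINT y:unit_cube|lebesgue. \<phi> y\<bar> \<le> 1"
      using abs_set_integral_unit_cube_le[OF \<phi>, of unit_cube] by (simp add: measure_unit_cube)
    ultimately have "(LINT y:?B|lebesgue. \<phi> y) / measure lebesgue ?B - (LINT y:unit_cube|lebesgue. \<phi> y) \<le> 2"
      by linarith
    then show "ereal (ball_discrepancy r 1 x \<phi>) \<le> ereal 2"
      by (simp add: ball_discrepancy_def)
  qed
  ultimately show ?thesis
    by (auto dest: order_trans)
qed

lemma rho_ge_discrepancy:
  assumes const: "discrepancy_constants TYPE('d::finite) c C"
    and mc: "monte_carlo TYPE('d) L CX" "3 * CX \<le> K" and t: "0 < t" and n: "n \<ge> 1"
  shows "ereal ((c * real n powr (- (1 / real CARD('d))) - t * (K * real n powr (- (1 / 2)))) / C) \<le> rho TYPE('d) L t"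
proof -
  let ?cn = "c * real n powr (- (1 / real CARD('d)))" and ?b = "K * real n powr (- (1 / 2))"
  have C: "0 < C"
    using const by (simp add: discrepancy_constants_def)
  obtain r and x :: "nat \<Rightarrow> real ^ 'd" where
    Y: "ereal ?cn \<le> (SUP \<phi>\<in>lipschitz_ball. ereal (ball_discrepancy r n x \<phi>))" and
    Z: "(SUP \<phi>\<in>L2_ball. ereal (ball_discrepancy r n x \<phi>)) \<le> ereal C" and
    X: "(SUP f\<in>tree_ball L 1. ereal (ball_discrepancy r n x f)) \<le> ereal (3 * CX * real n powr (- (1 / 2)))"
    using discrepancy_constantsE[OF const mc(1) n] .
  have "3 * CX * real n powr (- (1 / 2)) \<le> ?b"
    by (rule mult_right_mono[OF mc(2)]) simp
  then have X': "(SUP f\<in>tree_ball L 1. ereal (ball_discrepancy r n x f)) \<le> ereal ?b"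
    by (intro order_trans[OF X]) simp
  have le: "ereal ((ball_discrepancy r n x \<phi> - t * ?b) / C) \<le> rho TYPE('d) L t"
    if \<phi>: "\<phi> \<in> lipschitz_ball" for \<phi>
    unfolding rho_def
  proof (rule SUP_upper2[OF \<phi>], rule INF_greatest)
    fix f :: "real ^ 'd \<Rightarrow> real" assume f: "f \<in> tree_ball L t"
    have cont: "continuous_on unit_cube \<phi>" "continuous_on unit_cube f"
      using lipschitz_ball_bounds(2)[OF \<phi>] tree_ball_continuous[OF f] t by auto
    have "ball_discrepancy r n x \<phi> - ball_discrepancy r n x f \<le> C * L2_norm (\<lambda>x. \<phi> x - f x)"
      using ball_discrepancy_le_L2_norm[OF Z, of "\<lambda>x. \<phi> x - f x"] C cont
      by (simp add: ball_discrepancy_diff continuous_on_diff)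
    moreover have "ball_discrepancy r n x f \<le> t * ?b"
      by (rule ball_discrepancy_tree_ball_le[OF X' f t])
    ultimately have "ball_discrepancy r n x \<phi> - t * ?b \<le> C * L2_norm (\<lambda>x. \<phi> x - f x)"
      by linarith
    then show "ereal ((ball_discrepancy r n x \<phi> - t * ?b) / C) \<le> ereal (L2_norm (\<lambda>x. \<phi> x - f x))"
      using C by (simp add: divide_le_eq mult.commute)
  qed
  show ?thesis
  \<comment> \<open>The supremum over the Lipschitz ball need not be attained; a real
    \<open>z\<close> strictly between the two sides yields a \<open>\<phi>\<close> that is good
    enough.\<close>
  proof (rule ccontr)
    assume "\<not> ereal ((?cn - t * ?b) / C) \<le> rho TYPE('d) L t"
    then obtain z where z: "rho TYPE('d) L t < ereal z" "ereal z < ereal ((?cn - t * ?b) / C)"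
      by (meson ereal_dense2 not_le)
    then have "z * C + t * ?b < ?cn"
      using C by (simp add: less_divide_eq)
    then have "ereal (z * C + t * ?b) < ereal ?cn"
      by simp
    from less_le_trans[OF this Y]
    have "ereal (z * C + t * ?b) < (SUP \<phi>\<in>lipschitz_ball. ereal (ball_discrepancy r n x \<phi>))" .
    then obtain \<phi> :: "real ^ 'd \<Rightarrow> real" where "\<phi> \<in> lipschitz_ball" "z * C + t * ?b < ball_discrepancy r n x \<phi>"
      by (auto simp: less_SUP_iff)
    then have "ereal z \<le> ereal ((ball_discrepancy r n x \<phi> - t * ?b) / C)" and "\<phi> \<in> lipschitz_ball"
      using C by (auto simp: le_divide_eq)
    then show False
      using le z(1) by (meson not_le order_trans)
  qed
qed

text \<open>The number of points balances the two rates: \<open>n\<close> is the smallest integer for which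
  \<open>K * t * n powr (-1/2) \<le> (c / 2) * n powr (-1/d)\<close>.\<close>

lemma rho_ge_power:
  assumes const: "discrepancy_constants TYPE('d::finite) c C"
    and mc: "monte_carlo TYPE('d) L CX" "3 * CX \<le> K" and t: "0 < t" and K: "c / 2 \<le> K * t"
    and d: "d = real CARD('d)" "d > 2"
  shows "ereal (2 powr (- (1 / d)) * ((c / 2) powr (d / (d - 2)) / (C * K powr (2 / (d - 2)))) * t powr (- (2 / (d - 2))))
    \<le> rho TYPE('d) L t"
proof -
  have c: "0 < c" and C: "0 < C"
    using const by (simp_all add: discrepancy_constants_def)
  then have K0: "0 < K"
    using K t by (metis half_gt_zero less_le_trans zero_less_mult_pos2)
  define y where "y = K * t / (c / 2)"
  have y: "1 \<le> y"
    using K c by (simp add: y_def)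
  \<comment> \<open>The reciprocal of \<open>1 / 2 - 1 / d\<close>: the balance condition reads
    \<open>y \<le> n powr (1 / e)\<close>.\<close>
  define e where "e = 2 * d / (d - 2)"
  have e: "0 < e" "1 / 2 - 1 / d = 1 / e" "e / d = 2 / (d - 2)"
    using d(2) by (auto simp: e_def field_simps)
  define n where "n = nat \<lceil>y powr e\<rceil>"
  have ye: "1 \<le> y powr e"
    using y e by (simp add: ge_one_powr_ge_zero)
  have "real n = of_int \<lceil>y powr e\<rceil>"
    using ye unfolding n_def by (intro of_nat_nat) simp
  \<comment> \<open>As \<open>y powr e \<ge> 1\<close>, rounding up at most doubles it. This is the
    source of the factor \<open>2 powr (- (1 / d))\<close>.\<close>
  then have n: "y powr e \<le> real n" "real n \<le> 2 * y powr e"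
    using ye of_int_ceiling_le_add_one[of "y powr e"] by linarith+
  then have n1: "n \<ge> 1" "real n > 0"
    using ye by linarith+
  have "y = (y powr e) powr (1 / e)"
    using y e by (simp add: powr_powr)
  also have "\<dots> \<le> real n powr (1 / 2 - 1 / d)"
    unfolding e(2) by (rule powr_mono2) (use n(1) e(1) in auto)
  finally have "y * real n powr (- (1/2)) \<le> real n powr (1 / 2 - 1 / d) * real n powr (- (1/2))"
    by (intro mult_right_mono) auto
  also have "\<dots> = real n powr (- (1 / d))"
    by (simp flip: powr_add)
  finally have "(c / 2) * (y * real n powr (- (1/2))) \<le> (c / 2) * real n powr (- (1 / d))"
    using c by (intro mult_left_mono) auto
  then have balance: "t * (K * real n powr (- (1/2))) \<le> (c / 2) * real n powr (- (1 / d))"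
    using c by (simp add: y_def mult_ac)
  have "e * - (1 / d) = - (2 / (d - 2))"
    using e(3) by simp
  then have "2 powr (- (1 / d)) * y powr (- (2 / (d - 2))) = (2 * y powr e) powr (- (1 / d))"
    by (simp only: powr_mult powr_powr)
  also have "\<dots> \<le> real n powr (- (1 / d))"
    by (rule powr_mono2') (use n n1 d(2) in auto)
  finally have "(c / 2) * (2 powr (- (1 / d)) * y powr (- (2 / (d - 2)))) \<le> (c / 2) * real n powr (- (1 / d))"
    using c by (intro mult_left_mono) auto
  also have "\<dots> \<le> c * real n powr (- (1 / d)) - t * (K * real n powr (- (1/2)))"
    using balance by simp
  finally have le: "(c / 2) * (2 powr (- (1 / d)) * y powr (- (2 / (d - 2)))) / C
      \<le> (c * real n powr (- (1 / d)) - t * (K * real n powr (- (1/2)))) / C"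
    using C by (intro divide_right_mono) auto
  define p where "p = 2 / (d - 2)"
  have dp: "d / (d - 2) = 1 + p"
    using d(2) by (simp add: p_def field_simps)
  have cp: "(c / 2) powr (1 + p) = (c / 2) * (c / 2) powr p"
    using c by (simp only: powr_add powr_one)
  have "y powr (- p) = inverse (K powr p * t powr p / (c / 2) powr p)"
    using K0 t c unfolding y_def by (simp only: powr_minus powr_mult powr_divide)
  then have yp: "y powr (- p) = (c / 2) powr p * inverse (K powr p) * t powr (- p)"
    by (simp only: divide_inverse inverse_mult_distrib inverse_inverse_eq powr_minus mult_ac)
  have "2 powr (- (1 / d)) * ((c / 2) powr (d / (d - 2)) / (C * K powr (2 / (d - 2)))) * t powr (- (2 / (d - 2)))
      = (c / 2) * (2 powr (- (1 / d)) * y powr (- (2 / (d - 2)))) / C"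
    unfolding p_def [symmetric] dp cp yp
    by (simp only: divide_inverse inverse_mult_distrib mult_ac)
  also note le
  finally show ?thesis
    by (intro order_trans[OF _ rho_ge_discrepancy[OF const mc t n1(1), folded d(1)]]) simp
qed

text \<open>Rests on \<open>tree_log \<le> (L + 1) * ln (2 * d + 2)\<close> and
  \<open>L + 1 \<le> 2 ^ L\<close>. The constant 6 is relaxed to \<open>12 = 3 * 2 ^ 2\<close>, the
  factor in \<open>K\<close> at depth 0.\<close>

lemma monte_carlo_constant_le:
  "3 * (2 * sqrt (2 * tree_log TYPE('d::finite) L)) \<le> 12 * sqrt (2 * ln (2 * real CARD('d) + 2)) * 2 powr (real L / 2)"
proof -
  let ?m = "ln (2 * real CARD('d) + 2)"
  have ln2: "ln 2 \<le> ?m"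
    by (subst ln_le_cancel_iff) auto
  have "tree_log TYPE('d) L \<le> (real L + 1) * ?m"
    using mult_left_mono[OF ln2, of "real L"] by (simp add: tree_log_def distrib_right)
  also have "\<dots> \<le> 2 ^ L * ?m"
  proof (rule mult_right_mono)
    have "L < 2 ^ L"
      by (rule less_exp)
    then show "real L + 1 \<le> 2 ^ L"
      by (metis Suc_eq_plus1 Suc_leI of_nat_1 of_nat_add of_nat_le_iff of_nat_numeral of_nat_power)
  qed auto
  finally have "sqrt (2 * tree_log TYPE('d) L) \<le> sqrt (2 ^ L * (2 * ?m))"
    by simp
  also have "\<dots> = sqrt (2 ^ L) * sqrt (2 * ?m)"
    by (rule real_sqrt_mult)
  also have "sqrt (2 ^ L :: real) = (2 powr real L) powr (1 / 2)"
    by (simp add: powr_realpow powr_half_sqrt)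
  also have "\<dots> = 2 powr (real L / 2)"
    by (simp add: powr_powr)
  finally have "6 * sqrt (2 * tree_log TYPE('d) L) \<le> 6 * (2 powr (real L / 2) * sqrt (2 * ?m))"
    by simp
  also have "\<dots> \<le> 12 * (2 powr (real L / 2) * sqrt (2 * ?m))"
    by simp
  finally show ?thesis
    by (simp add: mult_ac)
qed

text \<open>The displayed constant itself decays like \<open>2 powr (- (2 * L / (d - 2)))\<close>,
  so the slower decay \<open>2 powr (- (L / (d - 2)))\<close> is a separate, stronger lower bound,
  with the same \<open>cbar\<close>. A lower bound on \<open>t\<close> is unavoidable: approximation
  by zero gives \<open>rho \<le> 1\<close>, while the power of \<open>t\<close> is unbounded near
  0.\<close>

theorem corollary3p6:
  fixes c C d :: real
  assumes dim: "CARD('d::finite) \<ge> 3"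
    and d: "d = real CARD('d)"
    and const: "discrepancy_constants TYPE('d) c C"
  shows "\<exists>cbar>0. \<forall>L::nat. \<forall>t>0.
     (let K = 3 * 2 ^ (L + 2) * sqrt (2 * ln (2 * d + 2));
          F = 2 powr (- (1 / d)) * ((c / 2) powr (d / (d - 2)) / (C * K powr (2 / (d - 2))))
                * t powr (- (2 / (d - 2)))
      in c / 2 \<le> K * t \<longrightarrow>
           rho TYPE('d) L t \<ge> ereal F \<and>
           F = cbar * 2 powr (- (2 * real L / (d - 2))) * t powr (- (2 / (d - 2)))) \<and>
     (t \<ge> 1 \<longrightarrow>
        rho TYPE('d) L t \<ge> ereal (cbar * 2 powr (- (real L / (d - 2))) * t powr (- (2 / (d - 2)))))"
proof -
  define B where "B = 12 * sqrt (2 * ln (2 * d + 2))"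
  define p where "p = 2 / (d - 2)"
  define cbar where "cbar = 2 powr (- (1 / d)) * ((c / 2) powr (d / (d - 2)) / (C * B powr p))"
  have d3: "d \<ge> 3"
    using dim d by simp
  have c: "0 < c" and C: "0 < C"
    using const by (simp_all add: discrepancy_constants_def)
  have "1 \<le> ln (2 * d + 2)"
    using tree_log_ge_1[where 'd = 'd, of 0] by (simp add: tree_log_def d)
  then have "1 \<le> sqrt (2 * ln (2 * d + 2))"
    by (intro real_sqrt_ge_one) simp
  then have B: "1 \<le> B"
    unfolding B_def by linarith
  have cbar: "0 < cbar"
    using c C B by (simp add: cbar_def)
  have mc: "3 * (2 * sqrt (2 * tree_log TYPE('d) L)) \<le> B * 2 powr (real L / 2)" for L
    using monte_carlo_constant_le[where 'd = 'd, of L] by (simp add: B_def d)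
  have F: "2 powr (- (1 / d)) * ((c / 2) powr (d / (d - 2)) / (C * (B * 2 powr s) powr (2 / (d - 2)))) * t powr (- (2 / (d - 2)))
      = cbar * 2 powr (- (s * p)) * t powr (- (2 / (d - 2)))" for s t
  proof -
    have "(B * 2 powr s) powr p = B powr p * 2 powr (s * p)"
      using B by (simp only: powr_mult powr_powr)
    then show ?thesis
      unfolding cbar_def p_def [symmetric]
      by (simp only: powr_minus divide_inverse inverse_mult_distrib mult_ac)
  qed
  have main: "ereal (cbar * 2 powr (- (s * p)) * t powr (- (2 / (d - 2)))) \<le> rho TYPE('d) L t"
    if "0 < t" "c / 2 \<le> B * 2 powr s * t" "real L / 2 \<le> s" for L s t
  proof -
    have "B * 2 powr (real L / 2) \<le> B * 2 powr s"
      using B that(3) by (intro mult_left_mono) auto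
    then have "3 * (2 * sqrt (2 * tree_log TYPE('d) L)) \<le> B * 2 powr s"
      using mc[of L] by linarith
    from rho_ge_power[OF const monte_carlo_tree this that(1,2) d] d3 show ?thesis
      unfolding F by simp
  qed
  show ?thesis
  proof (intro exI[of _ cbar] conjI allI impI)
    fix L :: nat and t :: real assume t: "0 < t"
    have K: "3 * 2 ^ (L + 2) * sqrt (2 * ln (2 * d + 2)) = B * 2 powr (real L)"
      by (simp add: B_def powr_realpow)
    have "real L * p = 2 * real L / (d - 2)"
      by (simp add: p_def)
    then show "let K = 3 * 2 ^ (L + 2) * sqrt (2 * ln (2 * d + 2));
          F = 2 powr (- (1 / d)) * ((c / 2) powr (d / (d - 2)) / (C * K powr (2 / (d - 2))))
                * t powr (- (2 / (d - 2)))
      in c / 2 \<le> K * t \<longrightarrow>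
           rho TYPE('d) L t \<ge> ereal F \<and>
           F = cbar * 2 powr (- (2 * real L / (d - 2))) * t powr (- (2 / (d - 2)))"
      using main[OF t, of "real L" L] unfolding Let_def K F by simp
  next
    fix L :: nat and t :: real assume t: "0 < t" "1 \<le> t"
    have "c / 2 \<le> 1 * 1 * 1"
      using discrepancy_constants_le_2[OF const] by simp
    also have "\<dots> \<le> B * 2 powr (real L / 2) * t"
      using B t by (intro mult_mono) (auto simp: ge_one_powr_ge_zero)
    finally have "ereal (cbar * 2 powr (- (real L / 2 * p)) * t powr (- (2 / (d - 2)))) \<le> rho TYPE('d) L t"
      by (rule main[OF t(1)]) simp
    then show "rho TYPE('d) L t \<ge> ereal (cbar * 2 powr (- (real L / (d - 2))) * t powr (- (2 / (d - 2))))"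
      by (simp add: p_def)
  qed (rule cbar)
qed

end
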